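(* Let $\varphi:\mathbb{R}^n\to(-\infty,\infty]$ be lower semicontinuous and prox-regular at $\bar x$ for $\bar x^*\in\partial\varphi(\bar x)$ with parameters $r\ge0$ and $\epsilon>0$, and let $\mathcal T^\varphi_\epsilon$ denote the $\varphi$-attentive $\epsilon$-localization of $\partial\varphi$ around $(\bar x,\bar x^* )$. (i) If $\mathcal T^\varphi_\epsilon$ is either proto-differentiable at $\bar x$ for $\bar x^*$ or semismooth$^*$ at $(\bar x,\bar x^* )$, then $$\lim_{\substack{(x,x^* )\to_\varphi(\bar x,\bar x^* )\\(x,x^* )\ne(\bar x,\bar x^* )}}\frac{\varphi(x)-\varphi(\bar x)-\frac12\langle x^*+\bar x^*,x-\bar x\rangle}{\|(x,x^* )-(\bar x,\bar x^* )\|^2}=0.$$ (ii) If $\mathcal T^\varphi_\epsilon$ is strictly proto-differentiable at $\bar x$ for $\bar x^*$, then $$\lim_{\substack{(x,x^* ),(y,y^* )\to_\varphi(\bar x,\bar x^* )\\(x,x^* )\ne(y,y^* )}}\frac{\varphi(y)-\varphi(x)-\frac12\langle y^*+x^*,y-x\rangle}{\|(y,y^* )-(x,x^* )\|^2}=0.$$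
   Context: $\mathcal B_r(x)$ is the open ball. For $\varphi:\mathbb{R}^n\to(-\infty,\infty]$ and $\bar x$ with $\varphi(\bar x)<\infty$, the regular subdifferential is $\widehat\partial\varphi(\bar x)=\{x^*\mid\liminf_{x\to\bar x}\frac{\varphi(x)-\varphi(\bar x)-\langle x^*,x-\bar x\rangle}{\|x-\bar x\|}\ge0\}$ and the limiting subdifferential is $\partial\varphi(\bar x)=\{x^*\mid\exists x_k\to\bar x,\ \varphi(x_k)\to\varphi(\bar x),\ x_k^*\to x^*,\ x_k^*\in\widehat\partial\varphi(x_k)\ \forall k\}$ ($\partial\varphi(x)=\emptyset$ if $\varphi(x)=\infty$). An lsc $\varphi$ is prox-regular at $\bar x$ for $\bar x^*$ with parameters $r\ge0$, $\epsilon>0$ if $\varphi(\bar x)$ is finite, $\bar x^*\in\partial\varphi(\bar x)$ and $\varphi(x')\ge\varphi(x)+\langle x^*,x'-x\rangle-\frac r2\|x'-x\|^2$ whenever $x'\in\mathcal B_\epsilon(\bar x)$ and $(x,x^* )\in\mathrm{gph}\,\partial\varphi\cap(\mathcal B_\epsilon(\bar x)\times\mathcal B_\epsilon(\bar x^* ))$ with $\varphi(x)<\varphi(\bar x)+\epsilon$. The $\varphi$-attentive $\epsilon$-localization $\mathcal T^\varphi_\epsilon:\mathbb{R}^n\rightrightarrows\mathbb{R}^n$ is given by $\mathrm{gph}\,\mathcal T^\varphi_\epsilon=\{(x,x^* )\in\mathrm{gph}\,\partial\varphi\cap(\mathcal B_\epsilon(\bar x)\times\mathcal B_\epsilon(\bar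 x^* ))\mid\varphi(x)<\varphi(\bar x)+\epsilon\}$. The notation $(x,x^* )\to_\varphi(\bar x,\bar x^* )$ means $(x,x^* )\in\mathrm{gph}\,\partial\varphi$, $(x,x^* )\to(\bar x,\bar x^* )$ and $\varphi(x)\to\varphi(\bar x)$. Set limits are in the Painlevé–Kuratowski sense: $\limsup_{t\to\bar t}C_t=\{x\mid\liminf_{t\to\bar t}\mathrm{dist}(x,C_t)=0\}$, $\liminf_{t\to\bar t}C_t=\{x\mid\limsup_{t\to\bar t}\mathrm{dist}(x,C_t)=0\}$; the limit exists if both coincide. For $\Omega\subset\mathbb{R}^N$, $\bar z\in\Omega$: $T_\Omega(\bar z)=\limsup_{t\downarrow0}\frac{\Omega-\bar z}{t}$, $\widehat N_\Omega(\bar z)=\{v\mid\langle v,w\rangle\le0\ \forall w\in T_\Omega(\bar z)\}$, $N_\Omega(\bar z)=\limsup_{z\to\bar z,\,z\in\Omega}\widehat N_\Omega(z)$. For a set-valued mapping $F$, with $\Omega=\mathrm{gph}\,F$ and $\bar z=(\bar x,\bar y)\in\Omega$: $F$ is proto-differentiable at $\bar x$ for $\bar y$ if $\lim_{t\downarrow0}\frac{\Omega-\bar z}{t}$ exists (and so equals $T_\Omega(\bar z)$); $F$ is strictly proto-differentiable at $\bar x$ for $\bar y$ if the limit of $\frac{\Omega-z}{t}$ exists as $z\to\bar z$, $z\in\Omega$, $t\downarrow0$; $F$ is semismooth$^*$ at $\bar z$ if for every $\eta>0$ there is $\delta>0$ such that $|\langle z^*,z-\bar z\rangle|\le\eta\|z-\bar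 z\|\,\|z^*\|$ for all $z\in\Omega\cap\mathcal B_\delta(\bar z)$ and all $z^*\in N_\Omega(z)$. *)

theory Defs
  imports "HOL-Analysis.Analysis"
begin

definition lsc :: "('a::topological_space \<Rightarrow> ereal) \<Rightarrow> bool" where
  "lsc \<phi> \<longleftrightarrow> (\<forall>x. \<phi> x \<le> Liminf (at x) \<phi>)"

definition gph :: "('a \<Rightarrow> 'b set) \<Rightarrow> ('a \<times> 'b) set" where
  "gph F = {(x, y). y \<in> F x}"

definition regular_subdiff :: "('a::euclidean_space \<Rightarrow> ereal) \<Rightarrow> 'a \<Rightarrow> 'a set" where
  "regular_subdiff \<phi> x =
     {v. \<phi> x < \<infinity> \<and>
         Liminf (at x) (\<lambda>u. (\<phi> u - \<phi> x - ereal (v \<bullet> (u - x))) / ereal (norm (u - x))) \<ge> 0}"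

definition limiting_subdiff :: "('a::euclidean_space \<Rightarrow> ereal) \<Rightarrow> 'a \<Rightarrow> 'a set" where
  "limiting_subdiff \<phi> x =
     {v. \<phi> x < \<infinity> \<and>
         (\<exists>(u :: nat \<Rightarrow> 'a) w. u \<longlonglongrightarrow> x \<and> (\<lambda>k. \<phi> (u k)) \<longlonglongrightarrow> \<phi> x \<and> w \<longlonglongrightarrow> v \<and>
            (\<forall>k. w k \<in> regular_subdiff \<phi> (u k)))}"

text \<open>Lower semicontinuity is not part of this predicate.\<close>

definition prox_regular ::
  "('a::euclidean_space \<Rightarrow> ereal) \<Rightarrow> 'a \<Rightarrow> 'a \<Rightarrow> real \<Rightarrow> real \<Rightarrow> bool" where
  "prox_regular \<phi> xb vb r \<epsilon> \<longleftrightarrow>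
     0 \<le> r \<and> 0 < \<epsilon> \<and> \<bar>\<phi> xb\<bar> \<noteq> \<infinity> \<and> vb \<in> limiting_subdiff \<phi> xb \<and>
     (\<forall>x' \<in> ball xb \<epsilon>. \<forall>(x, v) \<in> gph (limiting_subdiff \<phi>) \<inter> (ball xb \<epsilon> \<times> ball vb \<epsilon>).
        \<phi> x < \<phi> xb + ereal \<epsilon> \<longrightarrow>
        \<phi> x' \<ge> \<phi> x + ereal (v \<bullet> (x' - x)) - ereal (r / 2 * (norm (x' - x))\<^sup>2))"

definition attentive_localization ::
  "('a::euclidean_space \<Rightarrow> ereal) \<Rightarrow> 'a \<Rightarrow> 'a \<Rightarrow> real \<Rightarrow> 'a \<Rightarrow> 'a set" where
  "attentive_localization \<phi> xb vb \<epsilon> x =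
     {v. (x, v) \<in> gph (limiting_subdiff \<phi>) \<inter> (ball xb \<epsilon> \<times> ball vb \<epsilon>) \<and> \<phi> x < \<phi> xb + ereal \<epsilon>}"

text \<open>The filter of the convergence \<open>(x, v) \<rightarrow> (xb, vb)\<close> with \<open>(x, v)\<close> in the graph of the
  limiting subdifferential and \<open>\<phi> x \<rightarrow> \<phi> xb\<close>; the point \<open>(xb, vb)\<close> itself is not excluded.\<close>

definition attentive_at ::
  "('a::euclidean_space \<Rightarrow> ereal) \<Rightarrow> 'a \<Rightarrow> 'a \<Rightarrow> ('a \<times> 'a) filter" where
  "attentive_at \<phi> xb vb =
     inf (inf (nhds (xb, vb)) (filtercomap (\<lambda>(x, v). \<phi> x) (nhds (\<phi> xb))))
         (principal (gph (limiting_subdiff \<phi>)))"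

text \<open>Distance to a set, with value \<open>\<infinity>\<close> for the empty set (unlike \<^const>\<open>infdist\<close>).\<close>

definition set_edist :: "'a::metric_space \<Rightarrow> 'a set \<Rightarrow> ereal" where
  "set_edist x C = (INF c\<in>C. ereal (dist x c))"

definition PK_Limsup :: "'t filter \<Rightarrow> ('t \<Rightarrow> 'a::metric_space set) \<Rightarrow> 'a set" where
  "PK_Limsup F C = {x. Liminf F (\<lambda>t. set_edist x (C t)) = 0}"

definition PK_Liminf :: "'t filter \<Rightarrow> ('t \<Rightarrow> 'a::metric_space set) \<Rightarrow> 'a set" where
  "PK_Liminf F C = {x. Limsup F (\<lambda>t. set_edist x (C t)) = 0}"

definition PK_convergent :: "'t filter \<Rightarrow> ('t \<Rightarrow> 'a::metric_space set) \<Rightarrow> bool" where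
  "PK_convergent F C \<longleftrightarrow> PK_Limsup F C = PK_Liminf F C"

definition diff_quot_set :: "'a::real_vector set \<Rightarrow> 'a \<Rightarrow> real \<Rightarrow> 'a set" where
  "diff_quot_set \<Omega> z t = (\<lambda>w. (w - z) /\<^sub>R t) ` \<Omega>"

definition tangent_cone :: "'a::euclidean_space set \<Rightarrow> 'a \<Rightarrow> 'a set" where
  "tangent_cone \<Omega> z = PK_Limsup (at_right 0) (diff_quot_set \<Omega> z)"

definition regular_normal_cone :: "'a::euclidean_space set \<Rightarrow> 'a \<Rightarrow> 'a set" where
  "regular_normal_cone \<Omega> z = {v. \<forall>w \<in> tangent_cone \<Omega> z. v \<bullet> w \<le> 0}"

text \<open>As usual for set limits, \<open>z' \<rightarrow> z\<close> with \<open>z' \<in> \<Omega>\<close> allows \<open>z' = z\<close>, so the filter is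
  not \<open>at z within \<Omega>\<close>.\<close>

definition limiting_normal_cone :: "'a::euclidean_space set \<Rightarrow> 'a \<Rightarrow> 'a set" where
  "limiting_normal_cone \<Omega> z =
     PK_Limsup (inf (nhds z) (principal \<Omega>)) (regular_normal_cone \<Omega>)"

definition proto_differentiable ::
  "('a::euclidean_space \<Rightarrow> 'b::euclidean_space set) \<Rightarrow> 'a \<Rightarrow> 'b \<Rightarrow> bool" where
  "proto_differentiable F x y \<longleftrightarrow>
     (x, y) \<in> gph F \<and> PK_convergent (at_right 0) (diff_quot_set (gph F) (x, y))"

definition strictly_proto_differentiable ::
  "('a::euclidean_space \<Rightarrow> 'b::euclidean_space set) \<Rightarrow> 'a \<Rightarrow> 'b \<Rightarrow> bool" where
  "strictly_proto_differentiable F x y \<longleftrightarrow>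
     (x, y) \<in> gph F \<and>
     PK_convergent (inf (nhds (x, y)) (principal (gph F)) \<times>\<^sub>F at_right 0)
       (\<lambda>(z, t). diff_quot_set (gph F) z t)"

definition semismooth_star ::
  "('a::euclidean_space \<Rightarrow> 'b::euclidean_space set) \<Rightarrow> 'a \<times> 'b \<Rightarrow> bool" where
  "semismooth_star F zb \<longleftrightarrow>
     zb \<in> gph F \<and>
     (\<forall>\<eta>>0. \<exists>\<delta>>0. \<forall>z \<in> gph F \<inter> ball zb \<delta>. \<forall>w \<in> limiting_normal_cone (gph F) z.
        \<bar>w \<bullet> (z - zb)\<bar> \<le> \<eta> * norm (z - zb) * norm w)"

end

theory Submission
  imports Defs
begin

text \<open>The numerators in both limits measure the error of the trapezoidal rule for \<open>\<phi>\<close> between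
  two points \<open>p = (x, v)\<close> and \<open>q = (y, w)\<close> of the graph \<open>\<Omega>\<close> of the localization; call it
  \<open>D p q\<close>. Prox-regularity, used once from each end point, gives \<open>\<bar>D p q\<bar> \<le> C \<parallel>q - p\<parallel>\<^sup>2\<close>
  (\<open>trapezoid_defect_quadratic\<close>), and the task is to improve \<open>O\<close> to \<open>o\<close>. The second
  ingredient is the exact identity \<open>D p q = D p m + D m q + \<omega> (m - p, q - p) / 2\<close>, where \<open>\<omega>\<close>
  is the canonical symplectic form (\<open>trapezoid_defect_chain\<close>): the defect is additive up to
  the symplectic area of a triangle, and this area vanishes if the triangle is degenerate.

  Under (strict) proto-differentiability the graph is straight at small scales. If secants
  from \<open>p\<close> to \<open>q\<close> shrink and converge in direction to \<open>w\<close>, then existence of the set limit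
  forces \<open>\<Omega>\<close> to contain, for every fixed \<open>N\<close>, points that agree with \<open>p + (i / N) \<parallel>q - p\<parallel> w\<close>
  up to \<open>o (\<parallel>q - p\<parallel>)\<close>. Along this chain the symplectic areas are negligible and the
  quadratic bound contributes only \<open>N \<cdot> O (\<parallel>q - p\<parallel>\<^sup>2 / N\<^sup>2)\<close>. As \<open>N\<close> is arbitrary, the
  defect is \<open>o (\<parallel>q - p\<parallel>\<^sup>2)\<close>; compactness of the unit sphere makes this uniform in the
  direction (\<open>trapezoid_defect_little_o\<close>).

  Under semismoothness* the argument is variational (\<open>semismooth_little_o\<close>). By the chain
  identity, the function \<open>D z\<close> has along \<open>\<Omega>\<close> at \<open>p\<close> the gradient \<open>J (p - z) / 2\<close>, with \<open>J\<close>
  the symplectic rotation, which has no component along \<open>p - z\<close>. If \<open>\<plusminus> D z p \<ge> e \<parallel>p - z\<parallel>\<^sup>2\<close>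
  at points arbitrarily close to \<open>z\<close>, a penalized maximization of the ratio over an annulus
  yields a regular normal to \<open>\<Omega>\<close> at some point \<open>p\<close> whose component along \<open>p - z\<close> is a fixed
  fraction of its length, which semismoothness* excludes. The maximum exists because \<open>\<Omega>\<close> is
  closed near \<open>z\<close>; this is where lower semicontinuity enters
  (\<open>closed_attentive_localization\<close>).\<close>

section \<open>The trapezoid defect on a prox-regular graph\<close>

definition trapezoid_defect :: "('a::real_inner \<Rightarrow> real) \<Rightarrow> 'a \<times> 'a \<Rightarrow> 'a \<times> 'a \<Rightarrow> real" where
  "trapezoid_defect f p q =
     f (fst q) - f (fst p) - 1 / 2 * ((snd q + snd p) \<bullet> (fst q - fst p))"

text \<open>The symplectic rotation: \<open>rot a \<bullet> b\<close> is the canonical symplectic form on the product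
  space.\<close>

definition rot :: "'a::real_inner \<times> 'a \<Rightarrow> 'a \<times> 'a" where
  "rot a = (snd a, - fst a)"

lemma norm_rot [simp]: "norm (rot a) = norm a"
  by (simp add: rot_def norm_prod_def add.commute)

lemma rot_inner_self [simp]: "rot a \<bullet> a = 0"
  by (simp add: rot_def inner_prod_def inner_commute)

lemma rot_add: "rot (a + b) = rot a + rot b"
  by (simp add: rot_def)

lemma rot_scaleR: "rot (c *\<^sub>R a) = c *\<^sub>R rot a"
  by (simp add: rot_def)

lemma abs_rot_inner_le: "\<bar>rot a \<bullet> b\<bar> \<le> norm a * norm b"
  using Cauchy_Schwarz_ineq2[of "rot a" b] by simp

text \<open>The last term is the symplectic area of the triangle \<open>p\<close>, \<open>m\<close>, \<open>q\<close>. It is the only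
  obstruction to additivity, since the values of \<open>f\<close> telescope and the trapezoidal sums are
  bilinear.\<close>

lemma trapezoid_defect_chain:
  "trapezoid_defect f p q =
     trapezoid_defect f p m + trapezoid_defect f m q + 1 / 2 * (rot (m - p) \<bullet> (q - p))"
  by (simp add: trapezoid_defect_def rot_def inner_prod_def algebra_simps inner_commute)

lemma trapezoid_defect_telescope:
  "trapezoid_defect f (a 0) (a N) =
     (\<Sum>i<N. trapezoid_defect f (a i) (a (Suc i)) + 1 / 2 * (rot (a i - a 0) \<bullet> (a (Suc i) - a 0)))"
proof (induction N)
  case 0
  show ?case by (simp add: trapezoid_defect_def)
next
  case (Suc N)
  then show ?case
    using trapezoid_defect_chain[of f "a 0" "a (Suc N)" "a N"] by simp
qed

text \<open>The subgradient inequality at \<open>p\<close> bounds the defect from below and the one at \<open>q\<close> bounds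
  it from above; both leave, up to sign, the mixed term \<open>(w - v) \<bullet> (y - x) / 2\<close> and a
  multiple of \<open>\<parallel>y - x\<parallel>\<^sup>2\<close>.\<close>

lemma trapezoid_defect_quadratic:
  assumes r: "0 \<le> r"
    and pr: "\<And>p q. p \<in> \<Omega> \<Longrightarrow> q \<in> \<Omega> \<Longrightarrow>
      f (fst p) + snd p \<bullet> (fst q - fst p) - r / 2 * (norm (fst q - fst p))\<^sup>2 \<le> f (fst q)"
    and "p \<in> \<Omega>" "q \<in> \<Omega>"
  shows "\<bar>trapezoid_defect f p q\<bar> \<le> (1 + r) / 2 * (norm (q - p))\<^sup>2"
proof -
  obtain x v y w where p: "p = (x, v)" and q: "q = (y, w)" by (metis surj_pair)
  have 1: "f x + v \<bullet> (y - x) - r / 2 * (norm (y - x))\<^sup>2 \<le> f y"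
    and 2: "f y + w \<bullet> (x - y) - r / 2 * (norm (x - y))\<^sup>2 \<le> f x"
    using pr[of p q] pr[of q p] assms(3,4) by (simp_all add: p q)
  let ?X = "norm (y - x)" and ?V = "norm (w - v)"
  define S where "S = ?X\<^sup>2 + ?V\<^sup>2"
  have n: "(norm (q - p))\<^sup>2 = S"
    by (simp add: p q norm_prod_def S_def)
  have cs: "\<bar>(w - v) \<bullet> (y - x)\<bar> \<le> S"
  proof -
    have "\<bar>(w - v) \<bullet> (y - x)\<bar> \<le> ?V * ?X" by (rule Cauchy_Schwarz_ineq2)
    also have "\<dots> \<le> S"
      using sum_squares_bound[of ?V ?X]
        mult_nonneg_nonneg[OF norm_ge_zero norm_ge_zero, of "w - v" "y - x"]
      unfolding S_def by linarith
    finally show ?thesis .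
  qed
  have rr: "r / 2 * ?X\<^sup>2 \<le> r / 2 * S"
    using r unfolding S_def by (intro mult_left_mono) auto
  have sw: "norm (x - y) = ?X" by (rule norm_minus_commute)
  have D: "trapezoid_defect f p q = f y - f x - v \<bullet> (y - x) - 1 / 2 * ((w - v) \<bullet> (y - x))"
    "trapezoid_defect f p q = f y - f x + w \<bullet> (x - y) + 1 / 2 * ((w - v) \<bullet> (y - x))"
    by (simp_all add: trapezoid_defect_def p q algebra_simps)
  have "\<bar>trapezoid_defect f p q\<bar> \<le> 1 / 2 * S + r / 2 * S"
    using 1 2 cs rr D unfolding sw by linarith
  also have "\<dots> = (1 + r) / 2 * S" by (simp add: field_simps)
  finally show ?thesis unfolding n .
qed

text \<open>Subdivision gains a factor \<open>1 / N\<close>: each of the \<open>N\<close> steps has length at most \<open>3 t / N\<close>,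
  and the points lie within \<open>t / N\<^sup>2\<close> of a line through \<open>a 0\<close>, so that each symplectic area
  is of order \<open>t\<^sup>2 / N\<^sup>2\<close>. An accuracy of order \<open>t / N\<^sup>2\<close> is what keeps the sum of the \<open>N\<close>
  areas of order \<open>t\<^sup>2 / N\<close>.\<close>

lemma trapezoid_defect_chain_estimate:
  fixes a :: "nat \<Rightarrow> 'a::real_inner \<times> 'a"
  assumes C: "0 \<le> C"
    and bound: "\<And>p q. p \<in> \<Omega> \<Longrightarrow> q \<in> \<Omega> \<Longrightarrow> \<bar>trapezoid_defect f p q\<bar> \<le> C * (norm (q - p))\<^sup>2"
    and a: "\<And>i. i \<le> N \<Longrightarrow> a i \<in> \<Omega>"
    and N: "N > 0" and t: "t > 0" and w: "norm w = 1"
    and near: "\<And>i. i \<le> N \<Longrightarrow> norm (a i - a 0 - (real i / real N * t) *\<^sub>R w) \<le> t / (real N)\<^sup>2"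
  shows "\<bar>trapezoid_defect f (a 0) (a N)\<bar> \<le> (9 * C + 3 / 2) / real N * t\<^sup>2"
proof -
  let ?n = "real N"
  have n1: "1 \<le> ?n" using N by simp
  define b where "b i = a i - a 0 - (real i / ?n * t) *\<^sub>R w" for i
  have ab: "a i - a 0 = (real i / ?n * t) *\<^sub>R w + b i" for i by (simp add: b_def)
  have nb: "norm (b i) \<le> t / ?n\<^sup>2" if "i \<le> N" for i using near[OF that] by (simp add: b_def)
  have n2: "t / ?n\<^sup>2 \<le> t / ?n"
    using n1 t self_le_power[OF n1, of 2] by (intro divide_left_mono) auto
  have n3: "t / ?n\<^sup>2 \<le> t"
    using n1 t one_le_power[OF n1, of 2] by (simp add: pos_divide_le_eq)
  have step: "\<bar>trapezoid_defect f (a i) (a (Suc i)) + 1 / 2 * (rot (a i - a 0) \<bullet> (a (Suc i) - a 0))\<bar>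
      \<le> (9 * C + 3 / 2) * (t\<^sup>2 / ?n\<^sup>2)" if i: "i < N" for i
  proof -
    have "a (Suc i) - a i = (a (Suc i) - a 0) - (a i - a 0)" by simp
    also have "\<dots> = (t / ?n) *\<^sub>R w + b (Suc i) - b i"
      unfolding ab by (simp add: algebra_simps add_divide_distrib)
    finally have inc: "a (Suc i) - a i = (t / ?n) *\<^sub>R w + b (Suc i) - b i" .
    have "norm (a (Suc i) - a i) \<le> norm ((t / ?n) *\<^sub>R w) + norm (b (Suc i)) + norm (b i)"
      unfolding inc using norm_triangle_ineq4[of "(t / ?n) *\<^sub>R w + b (Suc i)" "b i"]
        norm_triangle_ineq[of "(t / ?n) *\<^sub>R w" "b (Suc i)"] by linarith
    also have "\<dots> \<le> t / ?n + t / ?n\<^sup>2 + t / ?n\<^sup>2"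
      using nb[of i] nb[of "Suc i"] i t w by simp
    also have "\<dots> \<le> 3 * (t / ?n)" using n2 by simp
    finally have "(norm (a (Suc i) - a i))\<^sup>2 \<le> (3 * (t / ?n))\<^sup>2"
      by (rule power_mono) simp
    then have "C * (norm (a (Suc i) - a i))\<^sup>2 \<le> C * (9 * (t\<^sup>2 / ?n\<^sup>2))"
      using C by (intro mult_left_mono) (simp_all add: power_mult_distrib power_divide)
    then have 1: "\<bar>trapezoid_defect f (a i) (a (Suc i))\<bar> \<le> 9 * C * (t\<^sup>2 / ?n\<^sup>2)"
      using order_trans[OF bound[OF a[of i] a[of "Suc i"]]] i by (auto simp: mult_ac)
    have frac: "0 \<le> real j / ?n * t" "real j / ?n * t \<le> t" if "j \<le> N" for j
      using that t N by (simp_all add: field_simps)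
    have sum3: "\<bar>x\<bar> \<le> 3 * u"
      if "x = x1 + x2 + x3" "\<bar>x1\<bar> \<le> u" "\<bar>x2\<bar> \<le> u" "\<bar>x3\<bar> \<le> u" for x x1 x2 x3 u :: real
      using that by linarith
    \<comment> \<open>The product of the two collinear main parts drops out since \<open>rot w \<bullet> w = 0\<close>.\<close>
    have "rot (a i - a 0) \<bullet> (a (Suc i) - a 0) =
        (real i / ?n * t) * (rot w \<bullet> b (Suc i)) + (real (Suc i) / ?n * t) * (rot (b i) \<bullet> w)
          + rot (b i) \<bullet> b (Suc i)"
      unfolding ab rot_add rot_scaleR
      by (simp only: inner_add_left inner_add_right inner_scaleR_left inner_scaleR_right
          rot_inner_self mult_zero_right add_0 add_0_right)
    moreover have "\<bar>(real i / ?n * t) * (rot w \<bullet> b (Suc i))\<bar> \<le> t * (t / ?n\<^sup>2)"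
      unfolding abs_mult using frac[of i] i w nb[of "Suc i"] abs_rot_inner_le[of w "b (Suc i)"] t
      by (intro mult_mono) auto
    moreover have "\<bar>(real (Suc i) / ?n * t) * (rot (b i) \<bullet> w)\<bar> \<le> t * (t / ?n\<^sup>2)"
      unfolding abs_mult using frac[of "Suc i"] i w nb[of i] abs_rot_inner_le[of "b i" w] t
      by (intro mult_mono) auto
    moreover have "\<bar>rot (b i) \<bullet> b (Suc i)\<bar> \<le> t * (t / ?n\<^sup>2)"
    proof -
      have "norm (b i) * norm (b (Suc i)) \<le> t * (t / ?n\<^sup>2)"
        using nb[of i] nb[of "Suc i"] i n3 t by (intro mult_mono) auto
      then show ?thesis using abs_rot_inner_le[of "b i" "b (Suc i)"] by linarith
    qed
    ultimately have "\<bar>rot (a i - a 0) \<bullet> (a (Suc i) - a 0)\<bar> \<le> 3 * (t * (t / ?n\<^sup>2))"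
      by (rule sum3)
    then have "\<bar>1 / 2 * (rot (a i - a 0) \<bullet> (a (Suc i) - a 0))\<bar> \<le> 3 / 2 * (t\<^sup>2 / ?n\<^sup>2)"
      by (simp add: power2_eq_square)
    with 1 have "\<bar>trapezoid_defect f (a i) (a (Suc i)) + 1 / 2 * (rot (a i - a 0) \<bullet> (a (Suc i) - a 0))\<bar>
        \<le> 9 * C * (t\<^sup>2 / ?n\<^sup>2) + 3 / 2 * (t\<^sup>2 / ?n\<^sup>2)"
      by linarith
    then show ?thesis by (simp only: distrib_right)
  qed
  have "\<bar>trapezoid_defect f (a 0) (a N)\<bar> \<le> (\<Sum>i<N. (9 * C + 3 / 2) * (t\<^sup>2 / ?n\<^sup>2))"
    unfolding trapezoid_defect_telescope
    by (rule order_trans[OF sum_abs]) (intro sum_mono step, simp)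
  also have "\<dots> = (9 * C + 3 / 2) / ?n * t\<^sup>2"
    using N by (simp add: power2_eq_square)
  finally show ?thesis .
qed

text \<open>The consequence of (strict) proto-differentiability that the argument uses: whenever
  shrinking secants of \<open>\<Omega>\<close>, based at points of \<open>B\<close> that tend to \<open>z\<close>, converge in direction
  to \<open>w\<close>, the set follows \<open>w\<close> from these base points at every fixed multiple \<open>s\<close> of the
  scale \<open>t\<close>. Taking \<open>B = {z}\<close> corresponds to proto-differentiability and \<open>B = \<Omega>\<close> to the
  strict version.\<close>

definition uniformly_derivable ::
  "'a::real_normed_vector set \<Rightarrow> 'a set \<Rightarrow> 'a \<Rightarrow> bool" where
  "uniformly_derivable \<Omega> B z \<longleftrightarrow>
     (\<forall>p q t w. (\<forall>k. p k \<in> B) \<longrightarrow> p \<longlonglongrightarrow> z \<longrightarrow> (\<forall>k. q k \<in> \<Omega>) \<longrightarrow> (\<forall>k::nat. 0 < (t k::real)) \<longrightarrow>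
        t \<longlonglongrightarrow> 0 \<longrightarrow> (\<lambda>k. (q k - p k) /\<^sub>R t k) \<longlonglongrightarrow> w \<longrightarrow>
        (\<forall>s>0. \<forall>e>0. \<forall>\<^sub>F k in sequentially. \<exists>m\<in>\<Omega>. norm (m - p k - (s * t k) *\<^sub>R w) \<le> e * t k))"

text \<open>A violating sequence of secants has, by compactness of the unit sphere, a subsequence with
  convergent directions \<open>w\<close>. Derivability then provides the \<open>N - 1\<close> intermediate points for
  the chain estimate, and an \<open>N\<close> that makes the resulting bound smaller than \<open>e\<close> contradicts
  the violation.\<close>

lemma trapezoid_defect_little_o:
  fixes z :: "'a::euclidean_space \<times> 'a"
  assumes C: "0 \<le> C"
    and bound: "\<And>p q. p \<in> \<Omega> \<Longrightarrow> q \<in> \<Omega> \<Longrightarrow> \<bar>trapezoid_defect f p q\<bar> \<le> C * (norm (q - p))\<^sup>2"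
    and B: "B \<subseteq> \<Omega>" and ud: "uniformly_derivable \<Omega> B z"
    and e: "e > 0"
  shows "\<exists>\<delta>>0. \<forall>p\<in>B \<inter> ball z \<delta>. \<forall>q\<in>\<Omega> \<inter> ball z \<delta>. \<bar>trapezoid_defect f p q\<bar> \<le> e * (norm (q - p))\<^sup>2"
proof (rule ccontr)
  assume neg: "\<not> ?thesis"
  have "\<exists>p q. p \<in> B \<inter> ball z (1 / real (Suc k)) \<and> q \<in> \<Omega> \<inter> ball z (1 / real (Suc k)) \<and>
      e * (norm (q - p))\<^sup>2 < \<bar>trapezoid_defect f p q\<bar>" for k
  proof -
    have "1 / real (Suc k) > 0" by simp
    then show ?thesis using neg by (meson not_le)
  qed
  then obtain p q where p: "\<And>k. p k \<in> B" and q: "\<And>k. q k \<in> \<Omega>"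
    and dp: "\<And>k. dist z (p k) < 1 / real (Suc k)" and dq: "\<And>k. dist z (q k) < 1 / real (Suc k)"
    and big: "\<And>k. e * (norm (q k - p k))\<^sup>2 < \<bar>trapezoid_defect f (p k) (q k)\<bar>"
    by (metis IntD1 IntD2 mem_ball)
  have lim0: "(\<lambda>k. 1 / real (Suc k)) \<longlonglongrightarrow> 0"
    by (rule LIMSEQ_Suc[OF lim_1_over_n])
  have pz: "p \<longlonglongrightarrow> z"
    unfolding tendsto_dist_iff[of p]
    by (rule tendsto_sandwich[OF _ _ tendsto_const lim0])
       (use dp in \<open>auto simp: dist_commute less_imp_le\<close>)
  have qz: "q \<longlonglongrightarrow> z"
    unfolding tendsto_dist_iff[of q]
    by (rule tendsto_sandwich[OF _ _ tendsto_const lim0])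
       (use dq in \<open>auto simp: dist_commute less_imp_le\<close>)
  have ne: "norm (q k - p k) > 0" for k
  proof (rule ccontr)
    assume "\<not> ?thesis"
    then have "q k = p k" by simp
    then show False using big[of k] by (simp add: trapezoid_defect_def)
  qed
  define d where "d k = (q k - p k) /\<^sub>R norm (q k - p k)" for k
  have "\<forall>k. d k \<in> sphere 0 1" using ne by (auto simp: d_def)
  then obtain w \<sigma> where w: "w \<in> sphere 0 1" and \<sigma>: "strict_mono \<sigma>" and dw: "(d \<circ> \<sigma>) \<longlonglongrightarrow> w"
    using compact_sphere[of "0 :: 'a \<times> 'a" 1] unfolding compact_def by metis
  define P Q where "P = p \<circ> \<sigma>" and "Q = q \<circ> \<sigma>"
  define t where "t k = norm (Q k - P k)" for k
  have P: "P \<longlonglongrightarrow> z" and Q: "Q \<longlonglongrightarrow> z"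
    unfolding P_def Q_def using pz qz \<sigma> by (auto intro: LIMSEQ_subseq_LIMSEQ)
  have t0: "t \<longlonglongrightarrow> 0"
    unfolding t_def using tendsto_norm[OF tendsto_diff[OF Q P]] by simp
  have tpos: "t k > 0" for k using ne by (simp add: t_def P_def Q_def)
  have dir: "(\<lambda>k. (Q k - P k) /\<^sub>R t k) \<longlonglongrightarrow> w"
    using dw by (simp add: t_def P_def Q_def d_def o_def)
  have PB: "P k \<in> B" and Q\<Omega>: "Q k \<in> \<Omega>" for k using p q by (simp_all add: P_def Q_def)
  let ?K = "9 * C + 3 / 2"
  have K: "?K > 0" using C by simp
  obtain N where N: "N > 0" "?K / real N < e"
  proof -
    obtain N where N: "real N > ?K / e" using reals_Archimedean2 by blast
    then have "real N > 0" using K e by (smt (verit) divide_pos_pos)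
    then show ?thesis using that[of N] N e by (auto simp: field_simps)
  qed
  have inter: "\<forall>\<^sub>F k in sequentially. \<exists>m\<in>\<Omega>. norm (m - P k - (s * t k) *\<^sub>R w) \<le> 1 / (real N)\<^sup>2 * t k"
    if "s > 0" for s
  proof -
    have "1 / (real N)\<^sup>2 > 0" using N by simp
    then show ?thesis
      using ud PB Q\<Omega> P tpos t0 dir that unfolding uniformly_derivable_def by blast
  qed
  have "\<forall>\<^sub>F k in sequentially. \<forall>i\<in>{0<..<N}.
      \<exists>m\<in>\<Omega>. norm (m - P k - (real i / real N * t k) *\<^sub>R w) \<le> 1 / (real N)\<^sup>2 * t k"
    using N by (intro eventually_ball_finite ballI inter) auto
  moreover have "\<forall>\<^sub>F k in sequentially. norm ((Q k - P k) /\<^sub>R t k - w) < 1 / (real N)\<^sup>2"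
    using dir N unfolding tendsto_iff dist_norm by simp
  ultimately have "\<forall>\<^sub>F k in sequentially. False"
  proof eventually_elim
    case (elim k)
    then obtain m where m: "\<And>i. i \<in> {0<..<N} \<Longrightarrow> m i \<in> \<Omega>"
      "\<And>i. i \<in> {0<..<N} \<Longrightarrow> norm (m i - P k - (real i / real N * t k) *\<^sub>R w) \<le> 1 / (real N)\<^sup>2 * t k"
      by metis
    \<comment> \<open>The end points are exactly \<open>P k\<close> and \<open>Q k\<close>; only the interior points come from derivability.\<close>
    define a where "a i = (if i = 0 then P k else if i = N then Q k else m i)" for i
    have end_near: "norm (Q k - P k - t k *\<^sub>R w) \<le> t k / (real N)\<^sup>2"
    proof -
      have "Q k - P k - t k *\<^sub>R w = t k *\<^sub>R ((Q k - P k) /\<^sub>R t k - w)"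
        using tpos[of k] by (simp add: algebra_simps)
      then have "norm (Q k - P k - t k *\<^sub>R w) = t k * norm ((Q k - P k) /\<^sub>R t k - w)"
        using tpos[of k] by (metis abs_of_pos norm_scaleR)
      also have "\<dots> \<le> t k * (1 / (real N)\<^sup>2)"
        using elim(2) tpos[of k] by (intro mult_left_mono) auto
      finally show ?thesis by simp
    qed
    have "\<bar>trapezoid_defect f (a 0) (a N)\<bar> \<le> ?K / real N * (t k)\<^sup>2"
    proof (rule trapezoid_defect_chain_estimate[where a = a and w = w, OF C bound _ N(1) tpos[of k]])
      show "a i \<in> \<Omega>" if "i \<le> N" for i
        using that m(1)[of i] PB Q\<Omega> B by (auto simp: a_def)
      show "norm w = 1" using w by simp
      show "norm (a i - a 0 - (real i / real N * t k) *\<^sub>R w) \<le> t k / (real N)\<^sup>2" if "i \<le> N" for i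
        using that m(2)[of i] end_near tpos[of k] N by (auto simp: a_def less_imp_le)
    qed
    also have "\<dots> \<le> e * (t k)\<^sup>2"
      using N(2) by (intro mult_right_mono) auto
    finally have "\<bar>trapezoid_defect f (P k) (Q k)\<bar> \<le> e * (norm (Q k - P k))\<^sup>2"
      using N by (simp add: a_def t_def)
    then show False using big[of "\<sigma> k"] by (simp add: P_def Q_def)
  qed
  then show False by simp
qed

section \<open>Set limits and regular normals\<close>

lemma set_edist_nonneg: "0 \<le> set_edist x C"
  by (auto simp: set_edist_def intro!: INF_greatest)

lemma set_edist_less_iff: "set_edist x C < ereal e \<longleftrightarrow> (\<exists>c\<in>C. dist x c < e)"
  by (auto simp: set_edist_def INF_less_iff)

text \<open>The filter must be proper because the lower limit along the trivial filter is \<open>\<infinity>\<close>.\<close>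

lemma PK_Limsup_iff:
  "x \<in> PK_Limsup F C \<longleftrightarrow> F \<noteq> bot \<and> (\<forall>e>0. \<exists>\<^sub>F t in F. set_edist x (C t) < ereal e)"
proof (intro iffI conjI allI impI)
  assume "x \<in> PK_Limsup F C"
  then have L: "Liminf F (\<lambda>t. set_edist x (C t)) = 0" by (simp add: PK_Limsup_def)
  then show "F \<noteq> bot" by (auto simp: top_ereal_def)
  fix e :: real assume e: "e > 0"
  show "\<exists>\<^sub>F t in F. set_edist x (C t) < ereal e"
  proof (rule ccontr)
    assume "\<not> ?thesis"
    then have "\<forall>\<^sub>F t in F. ereal e \<le> set_edist x (C t)"
      by (simp add: not_frequently not_less)
    then have "ereal e \<le> Liminf F (\<lambda>t. set_edist x (C t))" by (rule Liminf_bounded)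
    with L e show False by simp
  qed
next
  assume *: "F \<noteq> bot \<and> (\<forall>e>0. \<exists>\<^sub>F t in F. set_edist x (C t) < ereal e)"
  have "Liminf F (\<lambda>t. set_edist x (C t)) \<le> 0"
  proof (rule ccontr)
    assume "\<not> ?thesis"
    then obtain e where e: "0 < e" "ereal e < Liminf F (\<lambda>t. set_edist x (C t))"
      by (metis ereal_dense2 ereal_less(2) not_le)
    from less_LiminfD[OF e(2)] have "\<not> (\<exists>\<^sub>F t in F. set_edist x (C t) < ereal e)"
      by (auto simp: frequently_def not_less elim: eventually_mono)
    with * e show False by blast
  qed
  moreover have "0 \<le> Liminf F (\<lambda>t. set_edist x (C t))"
    by (intro Liminf_bounded always_eventually allI set_edist_nonneg)
  ultimately show "x \<in> PK_Limsup F C" by (simp add: PK_Limsup_def)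
qed

lemma PK_LiminfD:
  assumes "x \<in> PK_Liminf F C" "e > 0"
  shows "\<forall>\<^sub>F t in F. set_edist x (C t) < ereal e"
  using assms by (intro Limsup_lessD) (simp add: PK_Liminf_def)

text \<open>The limiting normals at \<open>z\<close> are limits over a filter that does not exclude \<open>z\<close> itself, so
  the constant choice \<open>z\<close> is admissible.\<close>

lemma regular_normal_cone_subset_limiting:
  assumes "z \<in> \<Omega>"
  shows "regular_normal_cone \<Omega> z \<subseteq> limiting_normal_cone \<Omega> z"
proof
  fix n assume n: "n \<in> regular_normal_cone \<Omega> z"
  have at: "P z" if "eventually P (inf (nhds z) (principal \<Omega>))" for P
    using that assms by (auto simp: eventually_inf_principal dest: eventually_nhds_x_imp_x)
  show "n \<in> limiting_normal_cone \<Omega> z"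
    unfolding limiting_normal_cone_def PK_Limsup_iff
  proof (intro conjI allI impI)
    show "inf (nhds z) (principal \<Omega>) \<noteq> bot"
      using at[of "\<lambda>_. False"] by (auto simp: trivial_limit_def)
    show "\<exists>\<^sub>F t in inf (nhds z) (principal \<Omega>). set_edist n (regular_normal_cone \<Omega> t) < ereal e"
      if "e > 0" for e
      unfolding frequently_def
    proof
      assume "\<forall>\<^sub>F t in inf (nhds z) (principal \<Omega>). \<not> set_edist n (regular_normal_cone \<Omega> t) < ereal e"
      from at[OF this] show False
        using n that by (auto simp: set_edist_less_iff)
    qed
  qed
qed

lemma regular_normal_coneI:
  fixes p n :: "'a::euclidean_space"
  assumes "\<And>e. e > 0 \<Longrightarrow> \<exists>d>0. \<forall>p'\<in>\<Omega>. dist p p' < d \<longrightarrow> n \<bullet> (p' - p) \<le> e * norm (p' - p)"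
  shows "n \<in> regular_normal_cone \<Omega> p"
  unfolding regular_normal_cone_def
proof (intro CollectI ballI)
  fix w assume w: "w \<in> tangent_cone \<Omega> p"
  have "n \<bullet> w \<le> e" if e: "e > 0" for e
  proof -
    \<comment> \<open>Chosen so that the error \<open>c (\<parallel>w\<parallel> + 1)\<close> from the hypothesis and the error \<open>c \<parallel>n\<parallel>\<close> from
      replacing \<open>w\<close> by a difference quotient add up to \<open>e\<close>.\<close>
    define c where "c = e / (norm w + 1 + norm n)"
    have den: "norm w + 1 + norm n > 0" by (smt (verit) norm_ge_zero)
    then have c: "c > 0" using e by (simp add: c_def)
    obtain d where d: "d > 0"
      and D: "\<And>p'. p' \<in> \<Omega> \<Longrightarrow> dist p p' < d \<Longrightarrow> n \<bullet> (p' - p) \<le> c * norm (p' - p)"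
      using assms[OF c] by blast
    define m where "m = min 1 c"
    have m: "m > 0" "m \<le> 1" "m \<le> c" using c by (auto simp: m_def)
    have "\<exists>\<^sub>F t in at_right 0. set_edist w (diff_quot_set \<Omega> p t) < ereal m"
      using w m by (auto simp: tangent_cone_def PK_Limsup_iff)
    moreover have "\<forall>\<^sub>F t in at_right 0. 0 < t \<and> t < d / (norm w + 1)"
    proof -
      have "0 < d / (norm w + 1)" using d by (intro divide_pos_pos) (simp_all add: add_nonneg_pos)
      then show ?thesis by (auto simp: eventually_at_right_field)
    qed
    ultimately obtain t where t: "0 < t" "t < d / (norm w + 1)"
      and "set_edist w (diff_quot_set \<Omega> p t) < ereal m"
      using frequently_eventually_frequently frequently_ex by (metis (mono_tags, lifting))
    then obtain p' where p': "p' \<in> \<Omega>" "dist w ((p' - p) /\<^sub>R t) < m"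
      by (auto simp: set_edist_less_iff diff_quot_set_def)
    define u where "u = (p' - p) /\<^sub>R t"
    have pu: "p' - p = t *\<^sub>R u" using t by (simp add: u_def)
    have wu: "norm (w - u) < m" using p' by (simp add: u_def dist_norm)
    then have nu: "norm u \<le> norm w + 1"
      using m norm_triangle_ineq3[of w u] by linarith
    have "norm (p' - p) \<le> t * (norm w + 1)" using nu t by (simp add: pu)
    also have "\<dots> < d" using t by (simp add: pos_less_divide_eq add_nonneg_pos)
    finally have "n \<bullet> (p' - p) \<le> c * norm (p' - p)"
      using D[OF p'(1)] by (simp add: dist_norm norm_minus_commute)
    then have "t * (n \<bullet> u) \<le> t * (c * norm u)" using t by (simp add: pu)
    then have 1: "n \<bullet> u \<le> c * norm u" using t by (simp add: mult_le_cancel_left)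
    have 2: "n \<bullet> (w - u) \<le> norm n * c"
    proof -
      have "n \<bullet> (w - u) \<le> norm n * norm (w - u)" by (rule norm_cauchy_schwarz)
      also have "\<dots> \<le> norm n * c" using wu m by (intro mult_left_mono) auto
      finally show ?thesis .
    qed
    have 3: "c * norm u \<le> c * (norm w + 1)" using nu c by (intro mult_left_mono) auto
    have "n \<bullet> w = n \<bullet> u + n \<bullet> (w - u)" by (simp add: inner_diff_right)
    also have "\<dots> \<le> c * (norm w + 1) + norm n * c" using 1 2 3 by linarith
    also have "\<dots> = c * (norm w + 1 + norm n)" by (simp add: algebra_simps)
    also have "\<dots> = e" using den by (simp add: c_def)
    finally show ?thesis .
  qed
  then show "n \<bullet> w \<le> 0" by (rule field_le_epsilon) simp
qed

text \<open>A Fermat rule. If \<open>E\<close> lies below the smooth function \<open>R\<close> near \<open>p\<close> on \<open>\<Omega>\<close> with contact at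
  \<open>p\<close>, while \<open>E\<close> grows along \<open>\<Omega>\<close> at least like the linear function \<open>b\<close> up to second order,
  then \<open>(b - a) \<bullet> (p' - p)\<close> has an upper bound of order \<open>o (\<parallel>p' - p\<parallel>)\<close> on \<open>\<Omega>\<close>.\<close>

lemma regular_normal_of_local_domination:
  fixes p :: "'a::euclidean_space"
  assumes der: "(R has_derivative (\<lambda>h. a \<bullet> h)) (at p)"
    and dom: "d > 0" "\<And>p'. p' \<in> \<Omega> \<Longrightarrow> dist p p' < d \<Longrightarrow> E p' \<le> R p'" and eq: "E p = R p"
    and low: "\<And>p'. p' \<in> \<Omega> \<Longrightarrow> E p + b \<bullet> (p' - p) - C * (norm (p' - p))\<^sup>2 \<le> E p'"
    and C: "0 \<le> C"
  shows "b - a \<in> regular_normal_cone \<Omega> p"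
proof (rule regular_normal_coneI)
  fix e :: real assume e: "e > 0"
  then obtain d1 where d1: "d1 > 0"
    "\<And>p'. norm (p' - p) < d1 \<Longrightarrow> norm (R p' - R p - a \<bullet> (p' - p)) \<le> e / 2 * norm (p' - p)"
    using der unfolding has_derivative_at_alt by (meson half_gt_zero)
  define d2 where "d2 = min (min d d1) (e / 2 / (C + 1))"
  have d2: "d2 > 0" using d1 dom e C by (simp add: d2_def)
  show "\<exists>d>0. \<forall>p'\<in>\<Omega>. dist p p' < d \<longrightarrow> (b - a) \<bullet> (p' - p) \<le> e * norm (p' - p)"
  proof (intro exI[of _ d2] conjI ballI impI d2)
    fix p' assume p': "p' \<in> \<Omega>" "dist p p' < d2"
    define x where "x = norm (p' - p)"
    have x: "0 \<le> x" "x < d1" "x < e / 2 / (C + 1)" "dist p p' < d"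
      using p' by (auto simp: x_def d2_def dist_norm norm_minus_commute)
    have "C * x \<le> (C + 1) * x" using x by (simp add: algebra_simps)
    also have "\<dots> \<le> e / 2"
    proof -
      have "x * (C + 1) < e / 2" using x(3) C by (subst (asm) pos_less_divide_eq) auto
      then show ?thesis by (simp add: mult.commute)
    qed
    finally have "C * x * x \<le> e / 2 * x" using x by (intro mult_right_mono) auto
    moreover have "(b - a) \<bullet> (p' - p) = b \<bullet> (p' - p) - a \<bullet> (p' - p)"
      by (simp add: inner_diff_left)
    moreover have "\<bar>R p' - R p - a \<bullet> (p' - p)\<bar> \<le> e / 2 * x"
      using d1(2)[of p'] x by (simp add: x_def)
    moreover have "E p + b \<bullet> (p' - p) - C * x * x \<le> E p'"
      using low[OF p'(1)] by (simp add: x_def power2_eq_square mult.assoc)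
    ultimately show "(b - a) \<bullet> (p' - p) \<le> e * norm (p' - p)"
      using dom(2)[OF p'(1) x(4)] eq unfolding x_def[symmetric] by linarith
  qed
qed

section \<open>Semismoothness* excludes quadratic growth of the defect\<close>

text \<open>The function \<open>E\<close> stands for \<open>\<plusminus>\<close> the defect with base point \<open>zb\<close>; the hypothesis \<open>expand\<close>
  says that its gradient along \<open>\<Omega>\<close> is \<open>rot (p - zb)\<close> up to a factor, hence orthogonal to
  \<open>p - zb\<close>.

  Let \<open>L\<close> be nearly the largest value that the ratio \<open>E p / \<parallel>p - zb\<parallel>\<^sup>2\<close> attains arbitrarily
  close to \<open>zb\<close>. At a small scale \<open>\<rho>\<close> the ratio reaches \<open>L\<close> on the sphere of radius \<open>\<rho>\<close> and
  stays below \<open>L + \<gamma>\<close> nearby. Subtracting a penalty that vanishes on this sphere and equals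
  \<open>\<gamma>\<close> on the boundary of an annulus around it forces the maximum over the annulus into its
  interior. There \<open>E\<close> is touched from above by a radial function whose gradient is
  \<open>2 \<beta> (p - zb)\<close> with \<open>\<beta> \<ge> e / 2\<close>, and the Fermat rule gives the normal
  \<open>n = (\<sigma> / 2) rot (p - zb) - 2 \<beta> (p - zb)\<close>. Its product with \<open>p - zb\<close> is
  \<open>- 2 \<beta> \<parallel>p - zb\<parallel>\<^sup>2\<close>, too large for semismoothness*.\<close>

lemma semismooth_little_o:
  fixes zb :: "'a::euclidean_space \<times> 'a"
  assumes zb: "zb \<in> \<Omega>" "E zb = 0"
    and expand: "\<And>p p'. p \<in> \<Omega> \<Longrightarrow> p' \<in> \<Omega> \<Longrightarrow>
        \<bar>E p' - E p - \<sigma> / 2 * (rot (p - zb) \<bullet> (p' - p))\<bar> \<le> C * (norm (p' - p))\<^sup>2"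
    and C: "0 \<le> C" and \<sigma>: "\<bar>\<sigma>\<bar> = 1"
    and R: "0 < R" "closed (\<Omega> \<inter> cball zb R)"
    and semi: "\<And>\<eta>. \<eta> > 0 \<Longrightarrow> \<exists>\<delta>>0. \<forall>z\<in>\<Omega> \<inter> ball zb \<delta>. \<forall>w\<in>limiting_normal_cone \<Omega> z.
        \<bar>w \<bullet> (z - zb)\<bar> \<le> \<eta> * norm (z - zb) * norm w"
    and e: "e > 0"
  shows "\<exists>\<delta>>0. \<forall>p\<in>\<Omega> \<inter> ball zb \<delta>. E p \<le> e * (norm (p - zb))\<^sup>2"
proof (rule ccontr)
  assume neg: "\<not> ?thesis"
  define N where "N p = (norm (p - zb))\<^sup>2" for p
  have Npos: "N p > 0" if "p \<noteq> zb" for p using that by (simp add: N_def)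
  have upper: "E p \<le> C * N p" if "p \<in> \<Omega>" for p
    using expand[OF zb(1) that] zb(2) by (simp add: rot_def inner_prod_def N_def)
  define S where "S = {a. e \<le> a \<and> (\<forall>\<delta>>0. \<exists>p\<in>\<Omega> \<inter> ball zb \<delta>. p \<noteq> zb \<and> a * N p \<le> E p)}"
  have eS: "e \<in> S"
    unfolding S_def
  proof (intro CollectI conjI allI impI)
    fix \<delta> :: real assume "\<delta> > 0"
    then obtain p where p: "p \<in> \<Omega> \<inter> ball zb \<delta>" "e * N p < E p"
      using neg unfolding N_def by (meson not_le)
    then have "p \<noteq> zb" using zb(2) by (auto simp: N_def)
    with p show "\<exists>p\<in>\<Omega> \<inter> ball zb \<delta>. p \<noteq> zb \<and> e * N p \<le> E p" by (auto intro: less_imp_le)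
  qed simp
  have S_le: "a \<le> C" if "a \<in> S" for a
  proof -
    have "\<exists>p\<in>\<Omega> \<inter> ball zb 1. p \<noteq> zb \<and> a * N p \<le> E p"
      using that by (simp add: S_def)
    then obtain p where p: "p \<in> \<Omega>" "p \<noteq> zb" "a * N p \<le> E p" by blast
    then have "a * N p \<le> C * N p" using upper[OF p(1)] by linarith
    then show ?thesis using Npos[OF p(2)] by simp
  qed
  have bdd: "bdd_above S" using S_le by (auto simp: bdd_above_def)
  define \<gamma> where "\<gamma> = e / 4"
  have \<gamma>: "\<gamma> > 0" using e by (simp add: \<gamma>_def)
  obtain L where L: "L \<in> S" "Sup S - \<gamma> < L"
    using less_cSupE[of "Sup S - \<gamma>" S] eS \<gamma> by auto
  have "L + \<gamma> \<notin> S" using cSup_upper[OF _ bdd, of "L + \<gamma>"] L by auto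
  then obtain \<delta>0 where \<delta>0: "\<delta>0 > 0"
    "\<And>p. p \<in> \<Omega> \<Longrightarrow> dist zb p < \<delta>0 \<Longrightarrow> p \<noteq> zb \<Longrightarrow> E p < (L + \<gamma>) * N p"
    using L(1) \<gamma> by (force simp: S_def not_le)
  have eL: "e \<le> L" using L(1) by (simp add: S_def)
  \<comment> \<open>Semismoothness* at this level would give \<open>2 \<beta> \<le> \<eta> (1 / 2 + 2 \<beta>)\<close>, hence \<open>\<beta> \<le> e / 4\<close>,
      whereas the \<open>\<beta>\<close> found below is at least \<open>e / 2\<close>.\<close>
  define \<eta> where "\<eta> = min (1 / 2) (e / 2)"
  have \<eta>: "\<eta> > 0" "\<eta> \<le> 1 / 2" "\<eta> \<le> e / 2" using e by (auto simp: \<eta>_def)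
  obtain \<delta>s where \<delta>s: "\<delta>s > 0" "\<And>z w. z \<in> \<Omega> \<Longrightarrow> dist zb z < \<delta>s \<Longrightarrow> w \<in> limiting_normal_cone \<Omega> z
      \<Longrightarrow> \<bar>w \<bullet> (z - zb)\<bar> \<le> \<eta> * norm (z - zb) * norm w"
    using semi[OF \<eta>(1)] by (metis IntI mem_ball)
  define \<delta> where "\<delta> = min (min \<delta>0 \<delta>s) R"
  have \<delta>: "\<delta> > 0" using \<delta>0 \<delta>s R by (simp add: \<delta>_def)
  then have "\<exists>p\<in>\<Omega> \<inter> ball zb (\<delta> / 2). p \<noteq> zb \<and> L * N p \<le> E p"
    using L(1) by (simp add: S_def)
  then obtain p1 where p1: "p1 \<in> \<Omega>" "dist zb p1 < \<delta> / 2" "p1 \<noteq> zb" "L * N p1 \<le> E p1"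
    by auto
  define \<rho> where "\<rho> = norm (p1 - zb)"
  have \<rho>: "\<rho> > 0" "\<rho> < \<delta> / 2" using p1 by (auto simp: \<rho>_def dist_norm norm_minus_commute)
  have N1: "N p1 = \<rho>\<^sup>2" by (simp add: N_def \<rho>_def)
  define K where "K = (\<Omega> \<inter> cball zb R) \<inter> {p. \<rho>\<^sup>2 / 2 \<le> N p \<and> N p \<le> 3 / 2 * \<rho>\<^sup>2}"
  have contN: "continuous_on A N" for A unfolding N_def by (intro continuous_intros)
  have openN: "open {p. \<rho>\<^sup>2 / 2 < N p \<and> N p < 3 / 2 * \<rho>\<^sup>2}"
    by (intro open_Collect_conj open_Collect_less contN continuous_on_const)
  have "compact K"
  proof -
    have "closed {p. \<rho>\<^sup>2 / 2 \<le> N p \<and> N p \<le> 3 / 2 * \<rho>\<^sup>2}"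
      by (intro closed_Collect_conj closed_Collect_le contN continuous_on_const)
    then have "closed K" unfolding K_def by (rule closed_Int[OF R(2)])
    moreover have "bounded K"
      by (rule bounded_subset[OF bounded_cball, of _ zb R]) (auto simp: K_def)
    ultimately show ?thesis by (simp add: compact_eq_bounded_closed)
  qed
  have p1K: "p1 \<in> K" using p1 \<delta> R N1 \<rho> by (auto simp: K_def \<delta>_def)
  have contE: "continuous_on \<Omega> E"
    unfolding continuous_on_def
  proof
    fix p assume p: "p \<in> \<Omega>"
    let ?b = "\<lambda>p'. \<bar>\<sigma> / 2 * (rot (p - zb) \<bullet> (p' - p))\<bar> + C * (norm (p' - p))\<^sup>2"
    have "\<forall>\<^sub>F p' in at p within \<Omega>. norm (E p' - E p) \<le> ?b p'"
      unfolding eventually_at_filter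
    proof (intro always_eventually allI impI)
      fix p' assume "p' \<in> \<Omega>"
      from expand[OF p this] show "norm (E p' - E p) \<le> ?b p'"
        unfolding real_norm_def by linarith
    qed
    moreover have "(?b \<longlongrightarrow> 0) (at p within \<Omega>)"
      by (rule tendsto_eq_intros refl | simp)+
    ultimately have "((\<lambda>p'. E p' - E p) \<longlongrightarrow> 0) (at p within \<Omega>)"
      by (rule Lim_null_comparison)
    then show "(E \<longlongrightarrow> E p) (at p within \<Omega>)" by (rule LIM_zero_cancel)
  qed
  \<comment> \<open>The penalty equals \<open>\<gamma>\<close> on both boundary spheres, where \<open>N p / \<rho>\<^sup>2\<close> is \<open>1 / 2\<close> or \<open>3 / 2\<close>.\<close>
  define H where "H p = E p / N p - 4 * \<gamma> * (N p / \<rho>\<^sup>2 - 1)\<^sup>2" for p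
  have KN: "N p > 0" if "p \<in> K" for p
  proof -
    have "0 < \<rho>\<^sup>2 / 2" using \<rho> by simp
    also have "\<rho>\<^sup>2 / 2 \<le> N p" using that by (simp add: K_def)
    finally show ?thesis .
  qed
  have "continuous_on K H"
    unfolding H_def using KN \<rho>
    by (intro continuous_intros contN continuous_on_subset[OF contE]) (force simp: K_def)+
  then obtain p2 where p2: "p2 \<in> K" and max: "\<And>p. p \<in> K \<Longrightarrow> H p \<le> H p2"
    using continuous_attains_sup[OF \<open>compact K\<close>, of H] p1K by blast
  have p2\<Omega>: "p2 \<in> \<Omega>" and N2: "N p2 > 0" using p2 KN by (auto simp: K_def)
  then have p2zb: "p2 \<noteq> zb" by (auto simp: N_def)
  have "L \<le> H p1" using p1(4) Npos[OF p1(3)] \<rho> by (simp add: H_def N1 pos_le_divide_eq)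
  then have LH: "L \<le> H p2" using max[OF p1K] by simp
  have near2: "dist zb p2 < \<delta>"
  proof -
    have "(norm (p2 - zb))\<^sup>2 \<le> (2 * \<rho>)\<^sup>2" using p2 \<rho> by (simp add: K_def N_def)
    then have "norm (p2 - zb) \<le> 2 * \<rho>" by (rule power2_le_imp_le) (use \<rho> in simp)
    then show ?thesis using \<rho> by (simp add: dist_norm norm_minus_commute)
  qed
  define s where "s = N p2 / \<rho>\<^sup>2"
  have small: "E p2 / N p2 < L + \<gamma>"
    using \<delta>0(2)[OF p2\<Omega> _ p2zb] near2 N2 by (simp add: \<delta>_def pos_divide_less_eq)
  have "(s - 1)\<^sup>2 \<noteq> 1 / 4"
  proof
    assume "(s - 1)\<^sup>2 = 1 / 4"
    then have "4 * \<gamma> * (s - 1)\<^sup>2 = \<gamma>" by simp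
    moreover have "H p2 = E p2 / N p2 - 4 * \<gamma> * (s - 1)\<^sup>2" by (simp add: H_def s_def)
    ultimately show False using small LH by linarith
  qed
  moreover have "(1 / 2 - 1)\<^sup>2 = (1 / 4 :: real)" "(3 / 2 - 1)\<^sup>2 = (1 / 4 :: real)"
    by (simp_all add: power2_eq_square)
  ultimately have sne: "s \<noteq> 1 / 2" "s \<noteq> 3 / 2" by metis+
  have \<rho>2: "\<rho>\<^sup>2 > 0" using \<rho> by simp
  have "\<rho>\<^sup>2 / 2 < N p2 \<and> N p2 < 3 / 2 * \<rho>\<^sup>2"
  proof -
    have "N p2 \<noteq> \<rho>\<^sup>2 / 2" "N p2 \<noteq> 3 / 2 * \<rho>\<^sup>2" using sne \<rho>2 by (auto simp: s_def)
    moreover have "\<rho>\<^sup>2 / 2 \<le> N p2" "N p2 \<le> 3 / 2 * \<rho>\<^sup>2" using p2 by (simp_all add: K_def)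
    ultimately show ?thesis by linarith
  qed
  then have "p2 \<in> ball zb R \<inter> {p. \<rho>\<^sup>2 / 2 < N p \<and> N p < 3 / 2 * \<rho>\<^sup>2}"
    using near2 by (simp add: \<delta>_def)
  then obtain d where d: "d > 0" "ball p2 d \<subseteq> ball zb R \<inter> {p. \<rho>\<^sup>2 / 2 < N p \<and> N p < 3 / 2 * \<rho>\<^sup>2}"
    using openN by (meson open_Int open_ball open_contains_ball)
  \<comment> \<open>Near \<open>p2\<close>, the maximality of \<open>H p2\<close> reads \<open>E \<le> Q\<close>, with equality at \<open>p2\<close>.\<close>
  define Q where "Q p = N p * (H p2 + 4 * \<gamma> * (N p / \<rho>\<^sup>2 - 1)\<^sup>2)" for p
  define \<beta> where "\<beta> = H p2 + 4 * \<gamma> * (s - 1)\<^sup>2 + 8 * \<gamma> * (s * (s - 1))"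
  have derN: "(N has_derivative (\<lambda>h. 2 * ((p2 - zb) \<bullet> h))) (at p2)"
    unfolding N_def power2_norm_eq_inner
    by (auto intro!: derivative_eq_intros simp: inner_commute)
  have derQ: "(Q has_derivative (\<lambda>h. ((2 * \<beta>) *\<^sub>R (p2 - zb)) \<bullet> h)) (at p2)"
  proof -
    have "((\<lambda>y. y * (H p2 + 4 * \<gamma> * (y / \<rho>\<^sup>2 - 1)\<^sup>2)) has_real_derivative \<beta>) (at (N p2))"
    proof -
      have "((\<lambda>y. y * (H p2 + 4 * \<gamma> * (c * y - 1)\<^sup>2)) has_real_derivative
          H p2 + 4 * \<gamma> * (c * y0 - 1)\<^sup>2 + 8 * \<gamma> * (c * y0 * (c * y0 - 1))) (at y0)" for c y0
        by (auto intro!: derivative_eq_intros simp: algebra_simps power2_eq_square)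
      from this[of "inverse (\<rho>\<^sup>2)" "N p2"] show ?thesis
        by (simp add: \<beta>_def s_def divide_inverse mult.commute)
    qed
    from DERIV_compose_FDERIV[OF this derN] show ?thesis
      unfolding Q_def[abs_def] by (simp add: mult_ac)
  qed
  have domQ: "E p' \<le> Q p'" if "p' \<in> \<Omega>" "dist p2 p' < d" for p'
  proof -
    have "p' \<in> K" using that d(2) by (force simp: K_def)
    then have "E p' / N p' \<le> H p2 + 4 * \<gamma> * (N p' / \<rho>\<^sup>2 - 1)\<^sup>2"
      using max[of p'] by (simp add: H_def)
    then show ?thesis using KN[OF \<open>p' \<in> K\<close>] by (simp add: Q_def pos_divide_le_eq mult.commute)
  qed
  define n where "n = (\<sigma> / 2) *\<^sub>R rot (p2 - zb) - (2 * \<beta>) *\<^sub>R (p2 - zb)"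
  have "n \<in> regular_normal_cone \<Omega> p2"
    unfolding n_def
  proof (rule regular_normal_of_local_domination[OF derQ d(1) domQ _ _ C])
    show "E p2 = Q p2" using N2 by (simp add: Q_def H_def)
    show "E p2 + ((\<sigma> / 2) *\<^sub>R rot (p2 - zb)) \<bullet> (p' - p2) - C * (norm (p' - p2))\<^sup>2 \<le> E p'"
      if "p' \<in> \<Omega>" for p'
      using expand[OF p2\<Omega> that] unfolding inner_scaleR_left by linarith
  qed
  then have nL: "n \<in> limiting_normal_cone \<Omega> p2"
    using regular_normal_cone_subset_limiting[OF p2\<Omega>] by blast
  define x where "x = norm (p2 - zb)"
  have x: "x > 0" using p2zb by (simp add: x_def)
  have \<beta>: "\<beta> \<ge> e / 2"
  proof -
    have "s * (s - 1) \<ge> - 1 / 4"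
      using zero_le_power2[of "s - 1 / 2"] by (simp add: power2_eq_square algebra_simps)
    then have "8 * \<gamma> * (- 1 / 4) \<le> 8 * \<gamma> * (s * (s - 1))"
      using \<gamma> by (intro mult_left_mono) auto
    moreover have "0 \<le> 4 * \<gamma> * (s - 1)\<^sup>2" using \<gamma> by simp
    ultimately show ?thesis using LH eL unfolding \<beta>_def \<gamma>_def by linarith
  qed
  have "n \<bullet> (p2 - zb) = - (2 * \<beta> * x\<^sup>2)"
    by (simp add: n_def inner_diff_left x_def power2_norm_eq_inner)
  then have normal: "2 * \<beta> * x\<^sup>2 \<le> \<eta> * x * norm n"
    using \<delta>s(2)[OF p2\<Omega> _ nL] near2 \<beta> e by (simp add: \<delta>_def x_def)
  have n_le: "norm n \<le> (1 / 2 + 2 * \<beta>) * x"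
  proof -
    have "norm n \<le> norm ((\<sigma> / 2) *\<^sub>R rot (p2 - zb)) + norm ((2 * \<beta>) *\<^sub>R (p2 - zb))"
      unfolding n_def by (rule norm_triangle_ineq4)
    also have "\<dots> = (1 / 2 + 2 * \<beta>) * x"
      using \<sigma> \<beta> e by (simp add: x_def distrib_right)
    finally show ?thesis .
  qed
  have "2 * \<beta> * x\<^sup>2 \<le> \<eta> * x * norm n" by (rule normal)
  also have "\<dots> \<le> \<eta> * x * ((1 / 2 + 2 * \<beta>) * x)"
    using n_le \<eta> x by (intro mult_left_mono) auto
  also have "\<dots> = (\<eta> * (1 / 2 + 2 * \<beta>)) * x\<^sup>2"
    by (simp add: power2_eq_square mult_ac)
  finally have "(2 * \<beta>) * x\<^sup>2 \<le> (\<eta> * (1 / 2 + 2 * \<beta>)) * x\<^sup>2" .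
  then have 1: "2 * \<beta> \<le> \<eta> * (1 / 2 + 2 * \<beta>)"
    by (rule mult_right_le_imp_le) (use x in simp)
  have 2: "\<eta> * (2 * \<beta>) \<le> 1 / 2 * (2 * \<beta>)" using \<eta> \<beta> e by (intro mult_right_mono) auto
  have "\<eta> * (1 / 2 + 2 * \<beta>) = \<eta> / 2 + \<eta> * (2 * \<beta>)" by (simp add: algebra_simps)
  with 1 2 \<beta> \<eta> e show False by linarith
qed

section \<open>Prox-regular functions and their attentive localizations\<close>

text \<open>Writing the attentive limits as a closure in the product with the function values turns
  the diagonal argument for iterated limits into the idempotence of the closure.\<close>

lemma limiting_subdiff_iff_closure:
  "v \<in> limiting_subdiff \<phi> x \<longleftrightarrow>
     \<phi> x < \<infinity> \<and> (x, \<phi> x, v) \<in> closure {(u, \<phi> u, w) |u w. w \<in> regular_subdiff \<phi> u}"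
    (is "?L \<longleftrightarrow> _ \<and> _ \<in> closure ?S")
proof (intro iffI conjI)
  assume ?L
  then show "\<phi> x < \<infinity>" by (simp add: limiting_subdiff_def)
  from \<open>?L\<close> obtain u w where "u \<longlonglongrightarrow> x" "(\<lambda>k. \<phi> (u k)) \<longlonglongrightarrow> \<phi> x" "w \<longlonglongrightarrow> v"
    "\<And>k. w k \<in> regular_subdiff \<phi> (u k)"
    by (auto simp: limiting_subdiff_def)
  then show "(x, \<phi> x, v) \<in> closure ?S"
    unfolding closure_sequential
    by (intro exI[of _ "\<lambda>k. (u k, \<phi> (u k), w k)"] conjI tendsto_Pair) auto
next
  assume A: "\<phi> x < \<infinity> \<and> (x, \<phi> x, v) \<in> closure ?S"
  then obtain X where X: "\<And>k. X k \<in> ?S" "X \<longlonglongrightarrow> (x, \<phi> x, v)"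
    unfolding closure_sequential by blast
  have "(\<lambda>k. fst (X k)) \<longlonglongrightarrow> x" "(\<lambda>k. fst (snd (X k))) \<longlonglongrightarrow> \<phi> x" "(\<lambda>k. snd (snd (X k))) \<longlonglongrightarrow> v"
    using tendsto_fst[OF X(2)] tendsto_fst[OF tendsto_snd[OF X(2)]]
      tendsto_snd[OF tendsto_snd[OF X(2)]] by simp_all
  moreover have "fst (snd (X k)) = \<phi> (fst (X k))" "snd (snd (X k)) \<in> regular_subdiff \<phi> (fst (X k))" for k
    using X(1)[of k] by auto
  ultimately show ?L
    using A unfolding limiting_subdiff_def
    by (intro CollectI conjI exI[of _ "\<lambda>k. fst (X k)"] exI[of _ "\<lambda>k. snd (snd (X k))"]) auto
qed

lemma limiting_subdiff_attentively_closed: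
  assumes "\<phi> x < \<infinity>" "X \<longlonglongrightarrow> x" "(\<lambda>k. \<phi> (X k)) \<longlonglongrightarrow> \<phi> x" "V \<longlonglongrightarrow> v"
    and "\<And>k. V k \<in> limiting_subdiff \<phi> (X k)"
  shows "v \<in> limiting_subdiff \<phi> x"
proof -
  have "(x, \<phi> x, v) \<in> closure {(u, \<phi> u, w) |u w. w \<in> regular_subdiff \<phi> u}"
    by (rule closed_sequentially[OF closed_closure, where f = "\<lambda>k. (X k, \<phi> (X k), V k)"])
       (use assms in \<open>auto simp: limiting_subdiff_iff_closure intro!: tendsto_Pair\<close>)
  then show ?thesis using assms(1) by (simp add: limiting_subdiff_iff_closure)
qed

lemma lsc_sequentially:
  assumes "lsc \<phi>" "X \<longlonglongrightarrow> x" "y < \<phi> x"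
  shows "\<forall>\<^sub>F k in sequentially. y < \<phi> (X k)"
proof -
  have "y < Liminf (at x) \<phi>" using assms(1,3) unfolding lsc_def by (meson less_le_trans)
  from less_LiminfD[OF this] have "\<forall>\<^sub>F u in nhds x. y < \<phi> u"
    using assms(3) by (auto simp: eventually_at_filter elim!: eventually_mono)
  then show ?thesis using assms(2) by (rule eventually_compose_filterlim)
qed

lemma mem_gph_attentive_localization:
  "p \<in> gph (attentive_localization \<phi> xb vb \<epsilon>) \<longleftrightarrow>
     snd p \<in> limiting_subdiff \<phi> (fst p) \<and> fst p \<in> ball xb \<epsilon> \<and> snd p \<in> ball vb \<epsilon> \<and>
     \<phi> (fst p) < \<phi> xb + ereal \<epsilon>"
  by (cases p) (auto simp: gph_def attentive_localization_def)

lemma attentive_localization_real: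
  assumes "\<And>x. \<phi> x \<noteq> -\<infinity>" "p \<in> gph (attentive_localization \<phi> xb vb \<epsilon>)"
  shows "\<phi> (fst p) = ereal (real_of_ereal (\<phi> (fst p)))"
  using assms(1)[of "fst p"] assms(2)
  by (cases "\<phi> (fst p)") (auto simp: mem_gph_attentive_localization)

lemma prox_regular_localization_ineq:
  assumes ninf: "\<And>x. \<phi> x \<noteq> -\<infinity>" and pr: "prox_regular \<phi> xb vb r \<epsilon>"
    and p: "p \<in> gph (attentive_localization \<phi> xb vb \<epsilon>)" and y: "y \<in> ball xb \<epsilon>"
  shows "ereal (real_of_ereal (\<phi> (fst p)) + snd p \<bullet> (y - fst p) - r / 2 * (norm (y - fst p))\<^sup>2) \<le> \<phi> y"
proof -
  have "\<phi> (fst p) + ereal (snd p \<bullet> (y - fst p)) - ereal (r / 2 * (norm (y - fst p))\<^sup>2) \<le> \<phi> y"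
  proof -
    have all: "\<forall>q\<in>gph (limiting_subdiff \<phi>) \<inter> (ball xb \<epsilon> \<times> ball vb \<epsilon>). case q of (x, v) \<Rightarrow>
        \<phi> x < \<phi> xb + ereal \<epsilon> \<longrightarrow>
        \<phi> x + ereal (v \<bullet> (y - x)) - ereal (r / 2 * (norm (y - x))\<^sup>2) \<le> \<phi> y"
      using pr y unfolding prox_regular_def by blast
    have mem: "p \<in> gph (limiting_subdiff \<phi>) \<inter> (ball xb \<epsilon> \<times> ball vb \<epsilon>)"
      and lt: "\<phi> (fst p) < \<phi> xb + ereal \<epsilon>"
      using p unfolding mem_gph_attentive_localization by (auto simp: gph_def mem_Times_iff split_beta)
    from bspec[OF all mem] lt show ?thesis by (cases p) simp
  qed
  then show ?thesis
    by (subst (asm) attentive_localization_real[OF ninf p]) simp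
qed

lemma prox_regular_base_mem:
  assumes "prox_regular \<phi> xb vb r \<epsilon>"
  shows "(xb, vb) \<in> gph (attentive_localization \<phi> xb vb \<epsilon>)"
proof -
  obtain a where "\<phi> xb = ereal a"
    using assms by (cases "\<phi> xb") (auto simp: prox_regular_def)
  then show ?thesis
    using assms by (simp add: prox_regular_def mem_gph_attentive_localization)
qed

text \<open>Along a convergent sequence of graph points, prox-regularity at these points bounds the
  function values asymptotically by the value at the limit, and lower semicontinuity gives
  the opposite inequality. Hence the convergence is attentive and the limit is again a
  limiting subgradient. The radius has to be small enough for the strict bound
  \<open>\<phi> x < \<phi> xb + \<epsilon>\<close> to survive in the limit.\<close>

lemma closed_attentive_localization:
  fixes \<phi> :: "'a::euclidean_space \<Rightarrow> ereal"
  assumes ninf: "\<And>x. \<phi> x \<noteq> -\<infinity>" and lsc: "lsc \<phi>" and pr: "prox_regular \<phi> xb vb r \<epsilon>"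
  shows "\<exists>R>0. closed (gph (attentive_localization \<phi> xb vb \<epsilon>) \<inter> cball (xb, vb) R)"
proof -
  define \<Omega> where "\<Omega> = gph (attentive_localization \<phi> xb vb \<epsilon>)"
  define f where "f x = real_of_ereal (\<phi> x)" for x
  have r: "0 \<le> r" and \<epsilon>: "0 < \<epsilon>" using pr by (auto simp: prox_regular_def)
  have base: "(xb, vb) \<in> \<Omega>" using prox_regular_base_mem[OF pr] by (simp add: \<Omega>_def)
  have fr: "\<phi> (fst p) = ereal (f (fst p))" if "p \<in> \<Omega>" for p
    using attentive_localization_real[OF ninf] that by (simp add: \<Omega>_def f_def)
  have fb: "\<phi> xb = ereal (f xb)" using fr[OF base] by simp
  have ineq: "ereal (f (fst p) + snd p \<bullet> (y - fst p) - r / 2 * (norm (y - fst p))\<^sup>2) \<le> \<phi> y"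
    if "p \<in> \<Omega>" "y \<in> ball xb \<epsilon>" for p y
    using prox_regular_localization_ineq[OF ninf pr] that by (simp add: \<Omega>_def f_def)
  \<comment> \<open>At graph points within the radius \<open>R \<le> 1\<close> the values of \<open>f\<close> exceed \<open>f xb\<close> by at most \<open>R M\<close>.\<close>
  define M where "M = norm vb + 1 + r / 2"
  have M: "M > 0" using r norm_ge_zero[of vb] unfolding M_def by linarith
  define R where "R = min 1 (min (\<epsilon> / 2) (\<epsilon> / 2 / M))"
  have R: "R > 0" "R \<le> 1" "R \<le> \<epsilon> / 2" "R \<le> \<epsilon> / 2 / M" using \<epsilon> M by (auto simp: R_def)
  have RM: "R * M \<le> \<epsilon> / 2" using R(4) M by (subst (asm) pos_le_divide_eq) auto
  have bound: "f (fst p) \<le> f xb + \<epsilon> / 2" if p: "p \<in> \<Omega>" "p \<in> cball (xb, vb) R" for p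
  proof -
    have "dist xb (fst p) \<le> R" "dist vb (snd p) \<le> R"
      using p(2) dist_fst_le[of "(xb, vb)" p] dist_snd_le[of "(xb, vb)" p] by auto
    then have d: "norm (xb - fst p) \<le> R" "norm (vb - snd p) \<le> R" by (simp_all add: dist_norm)
    have "norm (snd p) \<le> norm vb + 1"
      using d(2) R(2) norm_triangle_ineq3[of vb "snd p"] by linarith
    then have "norm (snd p) * norm (xb - fst p) \<le> (norm vb + 1) * R"
      using d(1) by (intro mult_mono) auto
    then have 1: "- ((norm vb + 1) * R) \<le> snd p \<bullet> (xb - fst p)"
      using Cauchy_Schwarz_ineq2[of "snd p" "xb - fst p"] by linarith
    have "(norm (xb - fst p))\<^sup>2 \<le> R * 1"
      unfolding power2_eq_square using d(1) R by (intro mult_mono) auto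
    then have 2: "r / 2 * (norm (xb - fst p))\<^sup>2 \<le> r / 2 * R"
      using r by (intro mult_left_mono) auto
    have "f (fst p) + snd p \<bullet> (xb - fst p) - r / 2 * (norm (xb - fst p))\<^sup>2 \<le> f xb"
      using ineq[OF p(1), of xb] \<epsilon> fb by simp
    moreover have "R * M = (norm vb + 1) * R + r / 2 * R" by (simp add: M_def algebra_simps)
    ultimately show ?thesis using 1 2 RM by linarith
  qed
  have "closed (\<Omega> \<inter> cball (xb, vb) R)"
    unfolding closed_sequential_limits
  proof (intro allI impI, elim conjE)
    fix P p assume P: "\<forall>k. P k \<in> \<Omega> \<inter> cball (xb, vb) R" and lim: "P \<longlonglongrightarrow> p"
    define X V where "X k = fst (P k)" and "V k = snd (P k)" for k
    define x v where "x = fst p" and "v = snd p"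
    have X: "X \<longlonglongrightarrow> x" and V: "V \<longlonglongrightarrow> v"
      using tendsto_fst[OF lim] tendsto_snd[OF lim]
      unfolding X_def[abs_def] V_def[abs_def] x_def v_def by simp_all
    have P\<Omega>: "P k \<in> \<Omega>" and Pc: "P k \<in> cball (xb, vb) R" for k using P by auto
    have pc: "p \<in> cball (xb, vb) R"
      using closed_sequentially[OF closed_cball] Pc lim by blast
    then have "dist xb x \<le> R" "dist vb v \<le> R"
      using dist_fst_le[of "(xb, vb)" p] dist_snd_le[of "(xb, vb)" p] by (auto simp: x_def v_def)
    then have xv: "x \<in> ball xb \<epsilon>" "v \<in> ball vb \<epsilon>" using R \<epsilon> by auto
    have \<phi>X: "\<phi> (X k) = ereal (f (X k))" for k using fr[OF P\<Omega>] by (simp add: X_def)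
    have fX: "f (X k) \<le> f xb + \<epsilon> / 2" for k using bound[OF P\<Omega> Pc] by (simp add: X_def)
    have up: "\<phi> x \<le> ereal (f xb + \<epsilon> / 2)"
    proof (rule ccontr)
      assume "\<not> ?thesis"
      then have "\<forall>\<^sub>F k in sequentially. ereal (f xb + \<epsilon> / 2) < \<phi> (X k)"
        by (intro lsc_sequentially[OF lsc X]) simp
      then obtain k where "ereal (f xb + \<epsilon> / 2) < \<phi> (X k)"
        by (auto simp: eventually_sequentially)
      then show False using fX[of k] \<phi>X[of k] by simp
    qed
    then have \<phi>x: "\<phi> x = ereal (f x)"
      using ninf[of x] by (cases "\<phi> x") (auto simp: f_def)
    define g where "g k = V k \<bullet> (x - X k) - r / 2 * (norm (x - X k))\<^sup>2" for k
    have "g \<longlonglongrightarrow> v \<bullet> (x - x) - r / 2 * (norm (x - x))\<^sup>2"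
      unfolding g_def by (intro tendsto_intros X V)
    then have g0: "g \<longlonglongrightarrow> 0" by simp
    have fg: "f (X k) + g k \<le> f x" for k
      using ineq[OF P\<Omega> xv(1), of k] unfolding g_def X_def V_def \<phi>x by simp
    have "(\<lambda>k. f (X k)) \<longlonglongrightarrow> f x"
    proof (rule order_tendstoI)
      fix a assume "a < f x"
      then show "\<forall>\<^sub>F k in sequentially. a < f (X k)"
        using lsc_sequentially[OF lsc X, of "ereal a"] by (simp add: \<phi>x \<phi>X)
    next
      fix a assume "f x < a"
      then have "\<forall>\<^sub>F k in sequentially. f x - a < g k" by (intro order_tendstoD(1)[OF g0]) simp
      then show "\<forall>\<^sub>F k in sequentially. f (X k) < a"
      proof eventually_elim
        case (elim k)
        then show ?case using fg[of k] by linarith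
      qed
    qed
    then have "(\<lambda>k. \<phi> (X k)) \<longlonglongrightarrow> \<phi> x" unfolding \<phi>x \<phi>X by (rule tendsto_ereal)
    then have "v \<in> limiting_subdiff \<phi> x"
      using P\<Omega> by (intro limiting_subdiff_attentively_closed[OF _ X _ V])
        (auto simp: \<phi>x X_def V_def \<Omega>_def mem_gph_attentive_localization)
    moreover have "\<phi> x < \<phi> xb + ereal \<epsilon>"
      using up \<epsilon> unfolding \<phi>x fb by simp
    ultimately show "p \<in> \<Omega> \<inter> cball (xb, vb) R"
      using xv pc by (simp add: \<Omega>_def mem_gph_attentive_localization x_def v_def)
  qed
  then show ?thesis using R(1) unfolding \<Omega>_def by blast
qed

section \<open>Proto-differentiability and derivability along secants\<close>

text \<open>Approach along one sequence puts \<open>w\<close> into the outer limit, and membership in the inner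
  limit is approach along every sequence. This is how a direction seen at one scale is
  carried over to other scales.\<close>

lemma PK_convergent_sequentially:
  assumes PK: "PK_convergent F C"
    and g: "filterlim g F sequentially"
    and approach: "\<And>e. e > 0 \<Longrightarrow> \<forall>\<^sub>F k in sequentially. set_edist w (C (g k)) < ereal e"
    and h: "filterlim h F sequentially" and e: "e > 0"
  shows "\<forall>\<^sub>F k in sequentially. set_edist w (C (h k)) < ereal e"
proof -
  have freq: "\<exists>\<^sub>F t in F. set_edist w (C t) < ereal a" if "a > 0" for a
    unfolding frequently_def
  proof
    assume "\<forall>\<^sub>F t in F. \<not> set_edist w (C t) < ereal a"
    from eventually_compose_filterlim[OF this g] approach[OF that]
    have "\<forall>\<^sub>F k in sequentially. False" by eventually_elim simp
    then show False by simp
  qed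
  have "F \<noteq> bot" using freq[of 1] by (auto simp: frequently_def)
  with freq have "w \<in> PK_Limsup F C" by (simp add: PK_Limsup_iff)
  then have "w \<in> PK_Liminf F C" using PK by (simp add: PK_convergent_def)
  from PK_LiminfD[OF this e] show ?thesis using h by (rule eventually_compose_filterlim)
qed

text \<open>The map \<open>\<iota>\<close> turns a base point and a step length into an index of the set limit, so that
  the limit with a fixed base point and the one with a moving base point are treated alike.\<close>

lemma uniformly_derivableI:
  fixes z :: "'a::real_normed_vector"
  assumes PK: "PK_convergent F C"
    and C: "\<And>p t. p \<in> B \<Longrightarrow> C (\<iota> p t) = diff_quot_set \<Omega> p t"
    and lim: "\<And>p t. (\<And>k. p k \<in> B) \<Longrightarrow> p \<longlonglongrightarrow> z \<Longrightarrow> (\<And>k. 0 < t k) \<Longrightarrow> t \<longlonglongrightarrow> 0 \<Longrightarrow>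
      filterlim (\<lambda>k::nat. \<iota> (p k) (t k)) F sequentially"
  shows "uniformly_derivable \<Omega> B z"
  unfolding uniformly_derivable_def
proof (intro allI impI)
  fix p q :: "nat \<Rightarrow> 'a" and t :: "nat \<Rightarrow> real" and w s e
  assume pB: "\<forall>k. p k \<in> B" and p: "p \<longlonglongrightarrow> z" and q: "\<forall>k. q k \<in> \<Omega>" and t: "\<forall>k. 0 < t k" "t \<longlonglongrightarrow> 0"
    and dir: "(\<lambda>k. (q k - p k) /\<^sub>R t k) \<longlonglongrightarrow> w" and s: "(0::real) < s" and e: "(0::real) < e"
  have "\<forall>\<^sub>F k in sequentially. set_edist w (C (\<iota> (p k) (s * t k))) < ereal (e / s)"
  proof (rule PK_convergent_sequentially[OF PK, where g = "\<lambda>k. \<iota> (p k) (t k)"])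
    show "filterlim (\<lambda>k. \<iota> (p k) (t k)) F sequentially"
      using pB p t by (intro lim) auto
    show "filterlim (\<lambda>k. \<iota> (p k) (s * t k)) F sequentially"
      using pB p t s tendsto_mult_right[OF t(2), of s] by (intro lim) auto
    show "e / s > 0" using e s by simp
    fix a :: real assume "a > 0"
    with dir have "\<forall>\<^sub>F k in sequentially. dist ((q k - p k) /\<^sub>R t k) w < a"
      by (rule tendstoD)
    then show "\<forall>\<^sub>F k in sequentially. set_edist w (C (\<iota> (p k) (t k))) < ereal a"
    proof eventually_elim
      case (elim k)
      then show ?case
        using pB q by (auto simp: C set_edist_less_iff diff_quot_set_def dist_commute)
    qed
  qed
  then show "\<forall>\<^sub>F k in sequentially. \<exists>m\<in>\<Omega>. norm (m - p k - (s * t k) *\<^sub>R w) \<le> e * t k"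
  proof eventually_elim
    case (elim k)
    then obtain m where m: "m \<in> \<Omega>" "dist w ((m - p k) /\<^sub>R (s * t k)) < e / s"
      using pB by (auto simp: C set_edist_less_iff diff_quot_set_def)
    define c where "c = s * t k"
    have c: "c > 0" using s t by (simp add: c_def)
    have "m - p k - c *\<^sub>R w = c *\<^sub>R ((m - p k) /\<^sub>R c - w)"
      using c by (simp add: scaleR_diff_right)
    then have "norm (m - p k - c *\<^sub>R w) = c * norm ((m - p k) /\<^sub>R c - w)"
      using c by (metis abs_of_pos norm_scaleR)
    also have "\<dots> \<le> c * (e / s)"
      using m(2) c by (intro mult_left_mono) (auto simp: dist_norm norm_minus_commute c_def)
    also have "\<dots> = e * t k" using s by (simp add: c_def)
    finally have "norm (m - p k - (s * t k) *\<^sub>R w) \<le> e * t k" by (simp add: c_def)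
    then show ?case using m(1) by blast
  qed
qed

lemma uniformly_derivable_of_proto:
  assumes "proto_differentiable F x y"
  shows "uniformly_derivable (gph F) {(x, y)} (x, y)"
proof (rule uniformly_derivableI[where \<iota> = "\<lambda>_ t. t"])
  show "PK_convergent (at_right 0) (diff_quot_set (gph F) (x, y))"
    using assms by (simp add: proto_differentiable_def)
  show "filterlim (\<lambda>k. t k) (at_right 0) sequentially"
    if "\<And>k. 0 < t k" "t \<longlonglongrightarrow> 0" for p :: "nat \<Rightarrow> 'a \<times> 'b" and t :: "nat \<Rightarrow> real"
    using that by (intro filterlim_at_withinI always_eventually) (auto simp: less_imp_neq[symmetric])
qed simp

lemma uniformly_derivable_of_strict_proto:
  assumes "strictly_proto_differentiable F x y"
  shows "uniformly_derivable (gph F) (gph F) (x, y)"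
proof (rule uniformly_derivableI[where \<iota> = Pair])
  show "PK_convergent (inf (nhds (x, y)) (principal (gph F)) \<times>\<^sub>F at_right 0)
       (\<lambda>(z, t). diff_quot_set (gph F) z t)"
    using assms by (simp add: strictly_proto_differentiable_def)
  show "filterlim (\<lambda>k. (p k, t k)) (inf (nhds (x, y)) (principal (gph F)) \<times>\<^sub>F at_right 0) sequentially"
    if "\<And>k. p k \<in> gph F" "p \<longlonglongrightarrow> (x, y)" "\<And>k. 0 < t k" "t \<longlonglongrightarrow> 0" for p t
    using that
    by (intro filterlim_Pair filterlim_at_withinI filterlim_inf[THEN iffD2] conjI
        filterlim_principal[THEN iffD2] always_eventually) (auto simp: less_imp_neq[symmetric])
qed simp

section \<open>The two limits\<close>

lemma eventually_attentive_at:
  assumes pr: "prox_regular \<phi> xb vb r \<epsilon>" and \<delta>: "\<delta> > 0"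
  shows "\<forall>\<^sub>F p in attentive_at \<phi> xb vb.
    p \<in> gph (attentive_localization \<phi> xb vb \<epsilon>) \<inter> ball (xb, vb) \<delta>"
proof -
  have \<epsilon>: "\<epsilon> > 0" using pr by (simp add: prox_regular_def)
  have "\<phi> xb < \<phi> xb + ereal \<epsilon>"
    using prox_regular_base_mem[OF pr] by (simp add: mem_gph_attentive_localization)
  then have "\<forall>\<^sub>F c in nhds (\<phi> xb). c < \<phi> xb + ereal \<epsilon>"
    by (intro eventually_nhds_in_open[of "{..<_}", simplified]) auto
  then have "\<forall>\<^sub>F p in filtercomap (\<lambda>(x, v). \<phi> x) (nhds (\<phi> xb)). \<phi> (fst p) < \<phi> xb + ereal \<epsilon>"
    unfolding eventually_filtercomap by (intro exI[of _ "\<lambda>c. c < \<phi> xb + ereal \<epsilon>"]) auto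
  then have 1: "\<forall>\<^sub>F p in attentive_at \<phi> xb vb. \<phi> (fst p) < \<phi> xb + ereal \<epsilon>"
    unfolding attentive_at_def by (rule filter_leD[rotated]) (simp add: le_infI1)
  have "\<forall>\<^sub>F p in nhds (xb, vb). p \<in> ball (xb, vb) (min \<delta> \<epsilon>)"
    using \<delta> \<epsilon> by (intro eventually_nhds_in_open) auto
  then have 2: "\<forall>\<^sub>F p in attentive_at \<phi> xb vb. p \<in> ball (xb, vb) (min \<delta> \<epsilon>)"
    unfolding attentive_at_def by (rule filter_leD[rotated]) (simp add: le_infI1)
  have 3: "\<forall>\<^sub>F p in attentive_at \<phi> xb vb. p \<in> gph (limiting_subdiff \<phi>)"
    unfolding attentive_at_def by (simp add: eventually_inf_principal)
  from 1 2 3 show ?thesis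
  proof eventually_elim
    case (elim p)
    have "dist xb (fst p) < \<epsilon>" "dist vb (snd p) < \<epsilon>"
      using elim(2) dist_fst_le[of "(xb, vb)" p] dist_snd_le[of "(xb, vb)" p] by auto
    with elim show ?case
      unfolding Int_iff mem_gph_attentive_localization by (auto simp: gph_def split_beta)
  qed
qed

lemma tendsto_ereal_quotient_0:
  assumes "\<And>e. e > 0 \<Longrightarrow> \<forall>\<^sub>F i in F. G i = ereal (D i / n i) \<and> 0 < n i \<and> \<bar>D i\<bar> \<le> e * n i"
  shows "(G \<longlongrightarrow> 0) F"
proof -
  have "((\<lambda>i. D i / n i) \<longlongrightarrow> 0) F"
  proof (rule tendstoI)
    fix e :: real assume "e > 0"
    then have "\<forall>\<^sub>F i in F. G i = ereal (D i / n i) \<and> 0 < n i \<and> \<bar>D i\<bar> \<le> e / 2 * n i"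
      by (intro assms) simp
    then show "\<forall>\<^sub>F i in F. dist (D i / n i) 0 < e"
    proof eventually_elim
      case (elim i)
      then have "\<bar>D i\<bar> / n i \<le> e / 2" by (simp add: pos_divide_le_eq)
      moreover have "\<bar>D i / n i\<bar> = \<bar>D i\<bar> / n i" using elim by (simp add: abs_divide)
      ultimately have "\<bar>D i / n i\<bar> < e" using \<open>e > 0\<close> by linarith
      then show ?case by (simp only: dist_real_def diff_zero)
    qed
  qed
  then have "((\<lambda>i. ereal (D i / n i)) \<longlongrightarrow> 0) F"
    unfolding zero_ereal_def by (rule tendsto_ereal)
  then show ?thesis
    by (rule Lim_transform_eventually) (use assms[of 1] in \<open>auto elim: eventually_mono\<close>)
qed

text \<open>The one-sided estimate is applied to the defect and to its negative. The chain identity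
  supplies the first-order expansion: for fixed \<open>z\<close> the remainder of the increment from \<open>p\<close>
  to \<open>p'\<close> is exactly the defect between these points.\<close>

lemma trapezoid_defect_little_o_semismooth:
  fixes z :: "'a::euclidean_space \<times> 'a"
  assumes C: "0 \<le> C"
    and bound: "\<And>p q. p \<in> gph F \<Longrightarrow> q \<in> gph F \<Longrightarrow> \<bar>trapezoid_defect f p q\<bar> \<le> C * (norm (q - p))\<^sup>2"
    and semi: "semismooth_star F z" and R: "0 < R" "closed (gph F \<inter> cball z R)"
    and e: "e > 0"
  shows "\<exists>\<delta>>0. \<forall>q\<in>gph F \<inter> ball z \<delta>. \<bar>trapezoid_defect f z q\<bar> \<le> e * (norm (q - z))\<^sup>2"
proof -
  have expand: "trapezoid_defect f z p' - trapezoid_defect f z p - 1 / 2 * (rot (p - z) \<bullet> (p' - p))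
      = trapezoid_defect f p p'" for p p'
  proof -
    have "rot (p - z) \<bullet> (p' - z) = rot (p - z) \<bullet> ((p' - p) + (p - z))" by simp
    also have "\<dots> = rot (p - z) \<bullet> (p' - p)" unfolding inner_add_right by simp
    finally show ?thesis using trapezoid_defect_chain[of f z p' p] by simp
  qed
  have one_sided: "\<exists>\<delta>>0. \<forall>p\<in>gph F \<inter> ball z \<delta>. \<sigma> * trapezoid_defect f z p \<le> e * (norm (p - z))\<^sup>2"
    if \<sigma>: "\<bar>\<sigma>\<bar> = 1" for \<sigma> :: real
  proof (rule semismooth_little_o[OF _ _ _ C \<sigma> R _ e])
    show "z \<in> gph F" using semi by (simp add: semismooth_star_def)
    show "\<sigma> * trapezoid_defect f z z = 0" by (simp add: trapezoid_defect_def)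
    show "\<exists>\<delta>>0. \<forall>p\<in>gph F \<inter> ball z \<delta>. \<forall>w\<in>limiting_normal_cone (gph F) p.
        \<bar>w \<bullet> (p - z)\<bar> \<le> \<eta> * norm (p - z) * norm w" if "\<eta> > 0" for \<eta>
      using semi that by (simp add: semismooth_star_def)
    fix p p' assume p: "p \<in> gph F" "p' \<in> gph F"
    have "\<sigma> * trapezoid_defect f z p' - \<sigma> * trapezoid_defect f z p - \<sigma> / 2 * (rot (p - z) \<bullet> (p' - p))
        = \<sigma> * trapezoid_defect f p p'"
      using arg_cong[OF expand[of p' p], of "\<lambda>t. \<sigma> * t"] by (simp add: right_diff_distrib)
    then show "\<bar>\<sigma> * trapezoid_defect f z p' - \<sigma> * trapezoid_defect f z p
        - \<sigma> / 2 * (rot (p - z) \<bullet> (p' - p))\<bar> \<le> C * (norm (p' - p))\<^sup>2"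
      using bound[OF p] \<sigma> by (simp add: abs_mult)
  qed
  obtain \<delta>1 where \<delta>1: "\<delta>1 > 0"
    "\<And>p. p \<in> gph F \<inter> ball z \<delta>1 \<Longrightarrow> trapezoid_defect f z p \<le> e * (norm (p - z))\<^sup>2"
    using one_sided[of 1] by auto
  obtain \<delta>2 where \<delta>2: "\<delta>2 > 0"
    "\<And>p. p \<in> gph F \<inter> ball z \<delta>2 \<Longrightarrow> - trapezoid_defect f z p \<le> e * (norm (p - z))\<^sup>2"
    using one_sided[of "- 1"] by auto
  show ?thesis
  proof (intro exI[of _ "min \<delta>1 \<delta>2"] conjI ballI)
    show "min \<delta>1 \<delta>2 > 0" using \<delta>1 \<delta>2 by simp
    fix p assume "p \<in> gph F \<inter> ball z (min \<delta>1 \<delta>2)"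
    then have "p \<in> gph F \<inter> ball z \<delta>1" "p \<in> gph F \<inter> ball z \<delta>2" by auto
    from \<delta>1(2)[OF this(1)] \<delta>2(2)[OF this(2)]
    show "\<bar>trapezoid_defect f z p\<bar> \<le> e * (norm (p - z))\<^sup>2" by (rule abs_leI)
  qed
qed

theorem theorem4p3:
  fixes \<phi> :: "real ^ 'n \<Rightarrow> ereal"
    and xb vb :: "real ^ 'n"
    and r \<epsilon> :: real
  assumes "\<And>x. \<phi> x \<noteq> -\<infinity>"
    and "lsc \<phi>"
    and "prox_regular \<phi> xb vb r \<epsilon>"
  shows
    "(proto_differentiable (attentive_localization \<phi> xb vb \<epsilon>) xb vb \<or>
      semismooth_star (attentive_localization \<phi> xb vb \<epsilon>) (xb, vb) \<longrightarrow>
        ((\<lambda>(x, v). (\<phi> x - \<phi> xb - ereal (1 / 2 * ((v + vb) \<bullet> (x - xb))))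
            / ereal ((norm ((x, v) - (xb, vb)))\<^sup>2)) \<longlongrightarrow> 0)
          (inf (attentive_at \<phi> xb vb) (principal {(x, v). (x, v) \<noteq> (xb, vb)})))
     \<and>
     (strictly_proto_differentiable (attentive_localization \<phi> xb vb \<epsilon>) xb vb \<longrightarrow>
        ((\<lambda>((x, v), (y, w)). (\<phi> y - \<phi> x - ereal (1 / 2 * ((w + v) \<bullet> (y - x))))
            / ereal ((norm ((y, w) - (x, v)))\<^sup>2)) \<longlongrightarrow> 0)
          (inf (attentive_at \<phi> xb vb \<times>\<^sub>F attentive_at \<phi> xb vb)
               (principal {((x, v), (y, w)). (x, v) \<noteq> (y, w)})))"
proof -
  note ninf = assms(1) and lsc = assms(2) and pr = assms(3)
  define F where "F = attentive_localization \<phi> xb vb \<epsilon>"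
  define f where "f x = real_of_ereal (\<phi> x)" for x
  define C where "C = (1 + r) / 2"
  let ?z = "(xb, vb)"
  have r: "0 \<le> r" using pr by (simp add: prox_regular_def)
  have C: "0 \<le> C" using r by (simp add: C_def)
  have z: "?z \<in> gph F" using prox_regular_base_mem[OF pr] by (simp add: F_def)
  have fr: "\<phi> (fst p) = ereal (f (fst p))" if "p \<in> gph F" for p
    using attentive_localization_real[OF ninf] that by (simp add: F_def f_def)
  have bound: "\<bar>trapezoid_defect f p q\<bar> \<le> C * (norm (q - p))\<^sup>2" if "p \<in> gph F" "q \<in> gph F" for p q
    unfolding C_def
  proof (rule trapezoid_defect_quadratic[OF r _ that])
    fix p q assume pq: "p \<in> gph F" "q \<in> gph F"
    have "fst q \<in> ball xb \<epsilon>"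
      using pq(2) unfolding F_def mem_gph_attentive_localization by blast
    then have "ereal (f (fst p) + snd p \<bullet> (fst q - fst p) - r / 2 * (norm (fst q - fst p))\<^sup>2) \<le> \<phi> (fst q)"
      using prox_regular_localization_ineq[OF ninf pr] pq(1) unfolding F_def f_def by blast
    then show "f (fst p) + snd p \<bullet> (fst q - fst p) - r / 2 * (norm (fst q - fst p))\<^sup>2 \<le> f (fst q)"
      unfolding fr[OF pq(2)] by simp
  qed
  have quotient: "(\<phi> (fst q) - \<phi> (fst p) - ereal (1 / 2 * ((snd q + snd p) \<bullet> (fst q - fst p))))
      / ereal ((norm (q - p))\<^sup>2) = ereal (trapezoid_defect f p q / (norm (q - p))\<^sup>2)"
    if "p \<in> gph F" "q \<in> gph F" "p \<noteq> q" for p q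
    unfolding fr[OF that(1)] fr[OF that(2)] trapezoid_defect_def using that(3) by simp
  have near: "\<forall>\<^sub>F p in attentive_at \<phi> xb vb. p \<in> gph F \<inter> ball ?z \<delta>" if "\<delta> > 0" for \<delta>
    using eventually_attentive_at[OF pr that] by (simp add: F_def)
  show ?thesis
    unfolding F_def[symmetric]
  proof (intro conjI impI)
    assume A: "proto_differentiable F xb vb \<or> semismooth_star F ?z"
    have small: "\<exists>\<delta>>0. \<forall>q\<in>gph F \<inter> ball ?z \<delta>. \<bar>trapezoid_defect f ?z q\<bar> \<le> e * (norm (q - ?z))\<^sup>2"
      if e: "e > 0" for e
      using A
    proof
      assume "proto_differentiable F xb vb"
      then have "uniformly_derivable (gph F) {?z} ?z" by (rule uniformly_derivable_of_proto)
      then obtain \<delta> where "\<delta> > 0" "\<forall>p\<in>{?z} \<inter> ball ?z \<delta>. \<forall>q\<in>gph F \<inter> ball ?z \<delta>.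
          \<bar>trapezoid_defect f p q\<bar> \<le> e * (norm (q - p))\<^sup>2"
        using trapezoid_defect_little_o[where \<Omega> = "gph F" and B = "{?z}" and z = ?z,
            OF C bound _ _ e] z by blast
      then show ?thesis by (intro exI[of _ \<delta>]) auto
    next
      assume semi: "semismooth_star F ?z"
      obtain R where R: "R > 0" "closed (gph F \<inter> cball ?z R)"
        using closed_attentive_localization[OF ninf lsc pr] unfolding F_def by blast
      show ?thesis
        using C bound semi R e by (rule trapezoid_defect_little_o_semismooth)
    qed
    show "((\<lambda>(x, v). (\<phi> x - \<phi> xb - ereal (1 / 2 * ((v + vb) \<bullet> (x - xb))))
            / ereal ((norm ((x, v) - ?z))\<^sup>2)) \<longlongrightarrow> 0)
          (inf (attentive_at \<phi> xb vb) (principal {(x, v). (x, v) \<noteq> ?z}))"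
    proof (rule tendsto_ereal_quotient_0[where D = "trapezoid_defect f ?z" and n = "\<lambda>q. (norm (q - ?z))\<^sup>2"])
      fix e :: real assume "e > 0"
      from small[OF this] obtain \<delta> where \<delta>: "\<delta> > 0"
        "\<And>q. q \<in> gph F \<inter> ball ?z \<delta> \<Longrightarrow> \<bar>trapezoid_defect f ?z q\<bar> \<le> e * (norm (q - ?z))\<^sup>2"
        by blast
      show "\<forall>\<^sub>F q in inf (attentive_at \<phi> xb vb) (principal {(x, v). (x, v) \<noteq> ?z}).
          (case q of (x, v) \<Rightarrow> (\<phi> x - \<phi> xb - ereal (1 / 2 * ((v + vb) \<bullet> (x - xb))))
            / ereal ((norm ((x, v) - ?z))\<^sup>2)) = ereal (trapezoid_defect f ?z q / (norm (q - ?z))\<^sup>2) \<and>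
          0 < (norm (q - ?z))\<^sup>2 \<and> \<bar>trapezoid_defect f ?z q\<bar> \<le> e * (norm (q - ?z))\<^sup>2"
        unfolding eventually_inf_principal
        using near[OF \<delta>(1)]
      proof eventually_elim
        case (elim q)
        show ?case
        proof
          assume "q \<in> {(x, v). (x, v) \<noteq> ?z}"
          then have ne: "?z \<noteq> q" by auto
          then have "0 < (norm (q - ?z))\<^sup>2" by simp
          moreover have "(case q of (x, v) \<Rightarrow> (\<phi> x - \<phi> xb - ereal (1 / 2 * ((v + vb) \<bullet> (x - xb))))
            / ereal ((norm ((x, v) - ?z))\<^sup>2)) = ereal (trapezoid_defect f ?z q / (norm (q - ?z))\<^sup>2)"
            using quotient[OF z _ ne] elim by (simp only: split_beta fst_conv snd_conv prod.collapse Int_iff)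
          ultimately show "(case q of (x, v) \<Rightarrow> (\<phi> x - \<phi> xb - ereal (1 / 2 * ((v + vb) \<bullet> (x - xb))))
            / ereal ((norm ((x, v) - ?z))\<^sup>2)) = ereal (trapezoid_defect f ?z q / (norm (q - ?z))\<^sup>2) \<and>
            0 < (norm (q - ?z))\<^sup>2 \<and> \<bar>trapezoid_defect f ?z q\<bar> \<le> e * (norm (q - ?z))\<^sup>2"
            using \<delta>(2)[OF elim] by blast
        qed
      qed
    qed
  next
    assume "strictly_proto_differentiable F xb vb"
    then have ud: "uniformly_derivable (gph F) (gph F) ?z" by (rule uniformly_derivable_of_strict_proto)
    show "((\<lambda>((x, v), (y, w)). (\<phi> y - \<phi> x - ereal (1 / 2 * ((w + v) \<bullet> (y - x))))
            / ereal ((norm ((y, w) - (x, v)))\<^sup>2)) \<longlongrightarrow> 0)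
          (inf (attentive_at \<phi> xb vb \<times>\<^sub>F attentive_at \<phi> xb vb)
               (principal {((x, v), (y, w)). (x, v) \<noteq> (y, w)}))"
    proof (rule tendsto_ereal_quotient_0[where D = "\<lambda>(p, q). trapezoid_defect f p q"
          and n = "\<lambda>(p, q). (norm (q - p))\<^sup>2"])
      fix e :: real assume "e > 0"
      then obtain \<delta> where \<delta>: "\<delta> > 0" "\<And>p q. p \<in> gph F \<inter> ball ?z \<delta> \<Longrightarrow> q \<in> gph F \<inter> ball ?z \<delta> \<Longrightarrow>
          \<bar>trapezoid_defect f p q\<bar> \<le> e * (norm (q - p))\<^sup>2"
        using trapezoid_defect_little_o[where \<Omega> = "gph F", OF C bound subset_refl ud] by blast
      show "\<forall>\<^sub>F i in inf (attentive_at \<phi> xb vb \<times>\<^sub>F attentive_at \<phi> xb vb)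
               (principal {((x, v), (y, w)). (x, v) \<noteq> (y, w)}).
          (\<lambda>((x, v), (y, w)). (\<phi> y - \<phi> x - ereal (1 / 2 * ((w + v) \<bullet> (y - x))))
            / ereal ((norm ((y, w) - (x, v)))\<^sup>2)) i =
            ereal ((case i of (p, q) \<Rightarrow> trapezoid_defect f p q) / (case i of (p, q) \<Rightarrow> (norm (q - p))\<^sup>2)) \<and>
          0 < (case i of (p, q) \<Rightarrow> (norm (q - p))\<^sup>2) \<and>
          \<bar>case i of (p, q) \<Rightarrow> trapezoid_defect f p q\<bar> \<le> e * (case i of (p, q) \<Rightarrow> (norm (q - p))\<^sup>2)"
        (is "\<forall>\<^sub>F i in _. ?P i")
        unfolding eventually_inf_principal
      proof (rule eventually_mono[OF eventually_prodI[OF near[OF \<delta>(1)] near[OF \<delta>(1)]]])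
        fix i assume elim: "fst i \<in> gph F \<inter> ball ?z \<delta> \<and> snd i \<in> gph F \<inter> ball ?z \<delta>"
        obtain p q where i: "i = (p, q)" by (cases i)
        have p: "p \<in> gph F \<inter> ball ?z \<delta>" and q: "q \<in> gph F \<inter> ball ?z \<delta>" using elim by (simp_all add: i)
        show "i \<in> {((x, v), (y, w)). (x, v) \<noteq> (y, w)} \<longrightarrow> ?P i"
        proof
          assume "i \<in> {((x, v), (y, w)). (x, v) \<noteq> (y, w)}"
          then have ne: "p \<noteq> q" by (auto simp: i)
          then have "0 < (norm (q - p))\<^sup>2" by simp
          then show "?P i"
            using quotient[OF IntD1[OF p] IntD1[OF q] ne] \<delta>(2)[OF p q]
            by (simp only: i split_beta fst_conv snd_conv prod.collapse simp_thms)
        qed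
      qed
    qed
  qed
qed

end
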